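(* Let $p$ and $q$ be two arbitrary distributions on a finite domain $\mathcal X$, and suppose $\pi\in(0,1/2]$, $\delta\in(0,\pi/4)$, and $\epsilon\in(0,\mathrm{TV}(p,q)/2)$. There is a computationally efficient algorithm that takes $p$, $q$, and $\epsilon$ as inputs and computes distributions $p'$ and $q'$ such that $$n^*_{\mathrm{B,rob}}(p,q,\pi,\delta,\epsilon)\asymp n^*_{\mathrm B}(p',q',\pi,\delta).$$
   Context: $\mathrm{TV}$ is total variation distance, $\mathrm{TV}(p,q)=\frac12\sum_i|p_i-q_i|$. $n^*_{\mathrm B}(p,q,\pi,\delta)$ is the smallest $n\in\{0,1,\dots\}$ for which there is a test $\phi:\mathcal X^n\to\{p,q\}$ with $\pi\,\mathbb P_{X\sim p^{\otimes n}}\{\phi(X)\ne p\}+(1-\pi)\,\mathbb P_{X\sim q^{\otimes n}}\{\phi(X)\ne q\}\le\delta$. Robust version: for $\epsilon<\mathrm{TV}(p,q)/2$ let $D_1=\{\tilde p:\mathrm{TV}(p,\tilde p)<\epsilon\}$ and $D_2=\{\tilde q:\mathrm{TV}(q,\tilde q)<\epsilon\}$. $n^*_{\mathrm{B,rob}}(p,q,\pi,\delta,\epsilon)$ is the smallest $n$ for which there is a (possibly randomized) test $\phi$ from $\mathcal X^n$ to $\{p,q\}$ with $$\pi\sup_{\tilde p\in D_1}\mathbb P_{X\sim\tilde p^{\otimes n}}\{\phi(X)\ne p\}+(1-\pi)\sup_{\tilde q\in D_2}\mathbb P_{X\sim\tilde q^{\otimes n}}\{\phi(X)\ne q\}\le\delta.$$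 "Computationally efficient" means running in polynomial time (in particular in $|\mathcal X|$). The algorithm depends only on $p,q,\epsilon$, not on $\pi,\delta$. $A\asymp B$ means $cB\le A\le CB$ for absolute constants $c,C>0$. *)

theory Defs
  imports "HOL-Probability.Probability" "HOL-Computational_Algebra.Polynomial" "HOL-Library.Log_Nat"
begin

section \<open>Sample complexities\<close>

text \<open>A distribution on the finite domain \<open>X\<close> is a pmf \<open>p\<close> with \<open>set_pmf p \<subseteq> X\<close>.\<close>

definition tv :: "'a set \<Rightarrow> 'a pmf \<Rightarrow> 'a pmf \<Rightarrow> real" where
  "tv X p q = (1 / 2) * (\<Sum>x\<in>X. \<bar>pmf p x - pmf q x\<bar>)"

definition samples :: "'a set \<Rightarrow> nat \<Rightarrow> 'a list set" where
  "samples X n = {xs. set xs \<subseteq> X \<and> length xs = n}"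

text \<open>The infimum is taken in \<open>enat\<close>, so it is \<open>\<infinity>\<close> if no sample size works.\<close>

definition n_B :: "'a set \<Rightarrow> 'a pmf \<Rightarrow> 'a pmf \<Rightarrow> real \<Rightarrow> real \<Rightarrow> enat" where
  "n_B X p q \<pi> \<delta> = Inf {enat n | n. \<exists>\<phi> :: 'a list \<Rightarrow> 'a pmf.
     \<phi> \<in> samples X n \<rightarrow> {p, q} \<and>
     \<pi> * measure_pmf.prob (replicate_pmf n p) {xs. \<phi> xs \<noteq> p}
     + (1 - \<pi>) * measure_pmf.prob (replicate_pmf n q) {xs. \<phi> xs \<noteq> q} \<le> \<delta>}"

definition tv_ball :: "'a set \<Rightarrow> 'a pmf \<Rightarrow> real \<Rightarrow> 'a pmf set" where
  "tv_ball X p \<epsilon> = {p'. set_pmf p' \<subseteq> X \<and> tv X p p' < \<epsilon>}"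

text \<open>A randomized test is a Markov kernel: it maps a sample to a distribution on the
  two-element set of hypotheses.\<close>

definition n_B_rob :: "'a set \<Rightarrow> 'a pmf \<Rightarrow> 'a pmf \<Rightarrow> real \<Rightarrow> real \<Rightarrow> real \<Rightarrow> enat" where
  "n_B_rob X p q \<pi> \<delta> \<epsilon> = Inf {enat n | n. \<exists>\<phi> :: 'a list \<Rightarrow> 'a pmf pmf.
     (\<forall>xs \<in> samples X n. set_pmf (\<phi> xs) \<subseteq> {p, q}) \<and>
     \<pi> * (SUP p' \<in> tv_ball X p \<epsilon>.
            measure_pmf.prob (bind_pmf (replicate_pmf n p') \<phi>) {h. h \<noteq> p})
     + (1 - \<pi>) * (SUP q' \<in> tv_ball X q \<epsilon>.
            measure_pmf.prob (bind_pmf (replicate_pmf n q') \<phi>) {h. h \<noteq> q}) \<le> \<delta>}"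

text \<open>Two-sided comparison up to the factors \<open>c\<close> and \<open>C\<close>; both quantities must be finite,
  since they are minima over sample sizes.\<close>

definition comparable :: "real \<Rightarrow> real \<Rightarrow> enat \<Rightarrow> enat \<Rightarrow> bool" where
  "comparable c C a b \<longleftrightarrow>
     (\<exists>m n. a = enat m \<and> b = enat n \<and> c * real n \<le> real m \<and> real m \<le> C * real n)"


section \<open>A random access machine with real arithmetic\<close>

text \<open>Programs of a while-language with index variables (natural numbers, without
  multiplication, which keeps unit-cost index arithmetic polynomial) and
  arrays of reals. Real constants are integers, so a program cannot contain hidden real
  information, and it maps rational data to rational data. There is no rounding operation and
  no conversion between reals and indices. Division by zero gives zero.\<close>

type_synonym vname = string

datatype iexp = INum nat | IVar vname | IPlus iexp iexp | IMinus iexp iexp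

datatype rexp = RNum int | RArr vname iexp
  | RPlus rexp rexp | RMinus rexp rexp | RTimes rexp rexp | RDiv rexp rexp

datatype bexp = ILess iexp iexp | RLess rexp rexp | BNot bexp | BAnd bexp bexp

datatype com = Skip
  | IAssign vname iexp
  | RAssign vname iexp rexp
  | Seq com com
  | Cond bexp com com
  | While bexp com

type_synonym state = "(vname \<Rightarrow> nat) \<times> (vname \<Rightarrow> nat \<Rightarrow> real)"

fun ival :: "iexp \<Rightarrow> state \<Rightarrow> nat" where
  "ival (INum n) s = n"
| "ival (IVar x) s = fst s x"
| "ival (IPlus a b) s = ival a s + ival b s"
| "ival (IMinus a b) s = ival a s - ival b s"

fun rval :: "rexp \<Rightarrow> state \<Rightarrow> real" where
  "rval (RNum z) s = of_int z"
| "rval (RArr x i) s = snd s x (ival i s)"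
| "rval (RPlus a b) s = rval a s + rval b s"
| "rval (RMinus a b) s = rval a s - rval b s"
| "rval (RTimes a b) s = rval a s * rval b s"
| "rval (RDiv a b) s = rval a s / rval b s"

fun bval :: "bexp \<Rightarrow> state \<Rightarrow> bool" where
  "bval (ILess a b) s = (ival a s < ival b s)"
| "bval (RLess a b) s = (rval a s < rval b s)"
| "bval (BNot b) s = (\<not> bval b s)"
| "bval (BAnd b c) s = (bval b s \<and> bval c s)"

text \<open>Evaluating an expression costs \<open>w v\<close> for every value \<open>v\<close> of a subexpression. The weight
  \<open>\<lambda>_. 1\<close> counts arithmetic operations and memory accesses; \<open>bit_size\<close> below gives the
  logarithmic-cost model.\<close>

fun icost :: "(real \<Rightarrow> nat) \<Rightarrow> iexp \<Rightarrow> state \<Rightarrow> nat" where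
  "icost w (INum n) s = w (real n)"
| "icost w (IVar x) s = w (real (fst s x))"
| "icost w (IPlus a b) s = icost w a s + icost w b s + w (real (ival (IPlus a b) s))"
| "icost w (IMinus a b) s = icost w a s + icost w b s + w (real (ival (IMinus a b) s))"

fun rcost :: "(real \<Rightarrow> nat) \<Rightarrow> rexp \<Rightarrow> state \<Rightarrow> nat" where
  "rcost w (RNum z) s = w (of_int z)"
| "rcost w (RArr x i) s = icost w i s + w (rval (RArr x i) s)"
| "rcost w (RPlus a b) s = rcost w a s + rcost w b s + w (rval (RPlus a b) s)"
| "rcost w (RMinus a b) s = rcost w a s + rcost w b s + w (rval (RMinus a b) s)"
| "rcost w (RTimes a b) s = rcost w a s + rcost w b s + w (rval (RTimes a b) s)"
| "rcost w (RDiv a b) s = rcost w a s + rcost w b s + w (rval (RDiv a b) s)"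

fun bcost :: "(real \<Rightarrow> nat) \<Rightarrow> bexp \<Rightarrow> state \<Rightarrow> nat" where
  "bcost w (ILess a b) s = icost w a s + icost w b s + 1"
| "bcost w (RLess a b) s = rcost w a s + rcost w b s + 1"
| "bcost w (BNot b) s = bcost w b s + 1"
| "bcost w (BAnd b c) s = bcost w b s + bcost w c s + 1"

text \<open>\<open>exec w c s t s'\<close>: started in \<open>s\<close>, the program \<open>c\<close> terminates in \<open>s'\<close> at total cost \<open>t\<close>.\<close>

inductive exec :: "(real \<Rightarrow> nat) \<Rightarrow> com \<Rightarrow> state \<Rightarrow> nat \<Rightarrow> state \<Rightarrow> bool" for w where
  Skip: "exec w Skip s 1 s"
| IAssign: "exec w (IAssign x e) s (icost w e s + 1) ((fst s)(x := ival e s), snd s)"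
| RAssign: "exec w (RAssign x i e) s (icost w i s + rcost w e s + 1)
     (fst s, (snd s)(x := (snd s x)(ival i s := rval e s)))"
| Seq: "exec w c1 s t1 s1 \<Longrightarrow> exec w c2 s1 t2 s2 \<Longrightarrow> exec w (Seq c1 c2) s (t1 + t2) s2"
| CondTrue: "bval b s \<Longrightarrow> exec w c1 s t s' \<Longrightarrow> exec w (Cond b c1 c2) s (bcost w b s + t) s'"
| CondFalse: "\<not> bval b s \<Longrightarrow> exec w c2 s t s' \<Longrightarrow> exec w (Cond b c1 c2) s (bcost w b s + t) s'"
| WhileFalse: "\<not> bval b s \<Longrightarrow> exec w (While b c) s (bcost w b s) s"
| WhileTrue: "bval b s \<Longrightarrow> exec w c s t1 s1 \<Longrightarrow> exec w (While b c) s1 t2 s2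
     \<Longrightarrow> exec w (While b c) s (bcost w b s + t1 + t2) s2"

text \<open>Binary length of numerator plus denominator in lowest terms. The value is meaningful only
  for rational arguments.\<close>

definition bit_size :: "real \<Rightarrow> nat" where
  "bit_size x = (let (a, b) = quotient_of (THE r. x = of_rat r)
                 in floorlog 2 (nat \<bar>a\<bar>) + floorlog 2 (nat b))"

text \<open>Problem instances on the domain \<open>{..<k}\<close>: the size \<open>k\<close> is in an index variable, the
  probability vectors and the radius (at index 0) are in arrays, and all other memory is zero.\<close>

definition input_state :: "nat \<Rightarrow> nat pmf \<Rightarrow> nat pmf \<Rightarrow> real \<Rightarrow> state" where
  "input_state k p q \<epsilon> =
     ((\<lambda>_. 0)(''k'' := k),
      (\<lambda>_ _. 0)(''p'' := (\<lambda>i. if i < k then pmf p i else 0),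
               ''q'' := (\<lambda>i. if i < k then pmf q i else 0),
               ''eps'' := (\<lambda>i. if i = 0 then \<epsilon> else 0)))"

definition output_is :: "nat \<Rightarrow> state \<Rightarrow> nat pmf \<Rightarrow> nat pmf \<Rightarrow> bool" where
  "output_is k s p' q' \<longleftrightarrow> (\<forall>i<k. snd s ''p_out'' i = pmf p' i \<and> snd s ''q_out'' i = pmf q' i)"

definition rational_input :: "nat \<Rightarrow> nat pmf \<Rightarrow> nat pmf \<Rightarrow> real \<Rightarrow> bool" where
  "rational_input k p q \<epsilon> \<longleftrightarrow> (\<forall>i<k. pmf p i \<in> \<rat> \<and> pmf q i \<in> \<rat>) \<and> \<epsilon> \<in> \<rat>"

definition input_size :: "nat \<Rightarrow> nat pmf \<Rightarrow> nat pmf \<Rightarrow> real \<Rightarrow> nat" where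
  "input_size k p q \<epsilon> = k + (\<Sum>i<k. bit_size (pmf p i) + bit_size (pmf q i)) + bit_size \<epsilon>"

definition computes_within ::
  "(real \<Rightarrow> nat) \<Rightarrow> com \<Rightarrow> nat \<Rightarrow> nat pmf \<Rightarrow> nat pmf \<Rightarrow> real \<Rightarrow> nat \<Rightarrow> nat pmf \<Rightarrow> nat pmf \<Rightarrow> bool" where
  "computes_within w A k p q \<epsilon> b p' q' \<longleftrightarrow>
     (\<exists>t s. exec w A (input_state k p q \<epsilon>) t s \<and> t \<le> b \<and> output_is k s p' q')"

text \<open>Polynomial time in two senses: for arbitrary real input, polynomially many operations in the
  size of the domain; for rational input, in addition, polynomial bit cost in the bit length of
  the input. The polynomials \<open>T\<close> and \<open>B\<close> are parameters because they have to be chosen uniformly in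
  the instance.\<close>

definition efficiently_computes ::
  "com \<Rightarrow> nat poly \<Rightarrow> nat poly \<Rightarrow> nat \<Rightarrow> nat pmf \<Rightarrow> nat pmf \<Rightarrow> real \<Rightarrow> nat pmf \<Rightarrow> nat pmf \<Rightarrow> bool" where
  "efficiently_computes A T B k p q \<epsilon> p' q' \<longleftrightarrow>
     computes_within (\<lambda>_. 1) A k p q \<epsilon> (poly T k) p' q' \<and>
     (rational_input k p q \<epsilon> \<longrightarrow>
        computes_within bit_size A k p q \<epsilon> (poly B (input_size k p q \<epsilon>)) p' q')"

end

theory Submission
  imports Defs
begin

text \<open>Following Huber, write \<open>m = p + q\<close> and clip the ratio \<open>q / m\<close> to an interval \<open>[s, 1 - r]\<close> such that
  exactly mass \<open>\<epsilon>\<close> is moved at either end: \<open>\<Sum>i. max 0 (s m\<^sub>i - q\<^sub>i) = \<epsilon>\<close> and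
  \<open>\<Sum>i. max 0 (r m\<^sub>i - p\<^sub>i) = \<epsilon>\<close>. This gives \<open>p'\<close>, \<open>q'\<close> in the closed balls. Among all pmfs in the ball
  around \<open>p\<close>, \<open>p'\<close> maximises the expectation of every increasing function of \<open>log (q' / p')\<close>, and
  \<open>q'\<close> minimises it in the ball around \<open>q\<close>; by induction this carries over to products and sums of log-likelihood
  ratios. So the likelihood ratio test of \<open>p'\<close> against \<open>q'\<close> has its worst robust error at \<open>(p', q')\<close>, where
  it is Bayes optimal, and the two sample complexities are in fact equal. The level \<open>s\<close> is the minimum
  of \<open>(\<epsilon> + q(U)) / m(U)\<close> over the at most \<open>k\<close> sublevel sets \<open>U\<close> of \<open>q / m\<close>, which is computed by
  two nested loops; \<open>r\<close> is symmetric.\<close>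

section \<open>Bayes errors of product distributions\<close>

text \<open>The ratio is taken against \<open>m = p + q\<close> rather than against \<open>p\<close>
  so that it stays in \<open>[0, 1]\<close>, treats both ends alike and is not spoilt by a vanishing
  mass. Since \<open>s\<close> and \<open>r\<close> are positive, the log-likelihood ratio of the
  new pair is bounded even where only one of \<open>p\<close>, \<open>q\<close> has mass. The
  hypothesis on \<open>\<epsilon>\<close> enters through the level 1/2: the mass moved there would
  already be half the total variation distance, so both levels lie below 1/2, the two clips never
  meet and the new pair stays distinct. Tests in the two problems output different labels and are
  randomized in one problem only; they become comparable because both are measured against the same
  number, the sum over all samples of the smaller weighted mass. The cost analysis is parametric in
  the weight of a value, so that operation count and bit cost come from a single argument.\<close>

lemma finite_samples: "finite X \<Longrightarrow> finite (samples X n)"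
  unfolding samples_def by (rule finite_lists_length_eq)

lemma set_replicate_pmf_subset: "set_pmf p \<subseteq> X \<Longrightarrow> set_pmf (replicate_pmf n p) \<subseteq> samples X n"
  by (auto simp: set_replicate_pmf samples_def lists_eq_set)

lemma finite_set_replicate_pmf:
  "finite X \<Longrightarrow> set_pmf p \<subseteq> X \<Longrightarrow> finite (set_pmf (replicate_pmf n p))"
  by (meson finite_samples finite_subset set_replicate_pmf_subset)

lemma expectation_finite_support:
  fixes f :: "'a \<Rightarrow> real"
  assumes "finite X" "set_pmf p \<subseteq> X"
  shows "measure_pmf.expectation p f = (\<Sum>x\<in>X. pmf p x * f x)"
  using integral_measure_pmf[OF assms(1), of p f] assms(2) by auto

lemma expectation_replicate_pmf:
  fixes f :: "'a list \<Rightarrow> real"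
  assumes "finite X" "set_pmf p \<subseteq> X"
  shows "measure_pmf.expectation (replicate_pmf n p) f
    = (\<Sum>xs\<in>samples X n. pmf (replicate_pmf n p) xs * f xs)"
  by (intro expectation_finite_support finite_samples set_replicate_pmf_subset assms)

lemma expectation_replicate_pmf_Suc:
  fixes f :: "'a list \<Rightarrow> real"
  assumes "finite X" "set_pmf p \<subseteq> X"
  shows "measure_pmf.expectation (replicate_pmf (Suc n) p) f =
    (\<Sum>x\<in>X. pmf p x * measure_pmf.expectation (replicate_pmf n p) (\<lambda>xs. f (x # xs)))"
proof -
  have "replicate_pmf (Suc n) p = bind_pmf p (\<lambda>x. map_pmf ((#) x) (replicate_pmf n p))"
    by (simp add: map_pmf_def)
  then show ?thesis
    using assms finite_set_replicate_pmf[OF assms]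
    by (simp add: pmf_expectation_bind[OF assms(1) _ assms(2)] del: replicate_pmf.simps)
qed

lemma pmf_replicate_pmf:
  "pmf (replicate_pmf (length xs) p) xs = prod_list (map (pmf p) xs)"
proof (induction xs)
  case (Cons y ys)
  let ?R = "replicate_pmf (length ys) p"
  have "pmf (map_pmf ((#) x) ?R) (y # ys) = indicator {y} x * pmf ?R ys" for x
  proof (cases "x = y")
    case True
    then show ?thesis by (simp add: pmf_map_inj')
  next
    case False
    then show ?thesis by (auto simp: pmf_map vimage_def)
  qed
  then have "pmf (bind_pmf p (\<lambda>x. map_pmf ((#) x) ?R)) (y # ys) = pmf p y * pmf ?R ys"
    by (simp only: pmf_bind) (simp add: measure_pmf_single)
  with Cons show ?case by (simp add: map_pmf_def)
qed simp

lemma sum_samples_Suc: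
  assumes "finite X"
  shows "(\<Sum>xs\<in>samples X (Suc n). f xs) = (\<Sum>x\<in>X. \<Sum>xs\<in>samples X n. f (x # xs))"
proof -
  have *: "samples X (Suc n) = (\<lambda>(x, xs). x # xs) ` (X \<times> samples X n)"
    by (auto simp: samples_def length_Suc_conv image_iff)
  show ?thesis
    unfolding * by (subst sum.reindex) (auto simp: inj_on_def sum.cartesian_product case_prod_beta)
qed

lemma sum_samples_prod:
  fixes f :: "'a \<Rightarrow> real"
  assumes "finite X"
  shows "(\<Sum>xs\<in>samples X n. prod_list (map f xs)) = (\<Sum>x\<in>X. f x) ^ n"
proof (induction n)
  case 0
  have "samples X 0 = {[]}" by (auto simp: samples_def)
  then show ?case by simp
next
  case (Suc n)
  then show ?case
    by (simp add: sum_samples_Suc[OF assms] sum_distrib_left[symmetric] sum_distrib_right)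
qed

text \<open>On every sample a deterministic test pays one of the two weighted masses, so the
  pointwise minimum gives the least error of any test, randomized or not.\<close>

definition bayes_error :: "'a set \<Rightarrow> 'a pmf \<Rightarrow> 'a pmf \<Rightarrow> real \<Rightarrow> nat \<Rightarrow> real" where
  "bayes_error X p q \<pi> n = (\<Sum>xs\<in>samples X n.
     min (\<pi> * pmf (replicate_pmf n p) xs) ((1 - \<pi>) * pmf (replicate_pmf n q) xs))"

text \<open>With \<open>f\<close> as the probability of rejecting \<open>p\<close>, every sample
  contributes a convex combination of the two weighted masses, which is at least their
  minimum.\<close>

lemma bayes_error_le:
  assumes X: "finite X" "set_pmf p \<subseteq> X" "set_pmf q \<subseteq> X" and pi: "0 \<le> \<pi>" "\<pi> \<le> 1"
    and f: "\<And>xs. xs \<in> samples X n \<Longrightarrow> 0 \<le> f xs \<and> f xs \<le> 1"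
  shows "bayes_error X p q \<pi> n \<le> \<pi> * measure_pmf.expectation (replicate_pmf n p) f
     + (1 - \<pi>) * measure_pmf.expectation (replicate_pmf n q) (\<lambda>xs. 1 - f xs)"
proof -
  have "min a b \<le> t * a + (1 - t) * b" if "0 \<le> t" "t \<le> 1" for a b t :: real
    using mult_left_mono[of "min a b" a t] mult_left_mono[of "min a b" b "1 - t"] that
    by (simp add: algebra_simps)
  then have "bayes_error X p q \<pi> n \<le> (\<Sum>xs\<in>samples X n. f xs * (\<pi> * pmf (replicate_pmf n p) xs)
      + (1 - f xs) * ((1 - \<pi>) * pmf (replicate_pmf n q) xs))"
    unfolding bayes_error_def using f by (intro sum_mono) auto
  then show ?thesis
    using X by (simp add: expectation_replicate_pmf sum.distrib sum_distrib_left mult_ac)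
qed

text \<open>Samples that are null under both distributions contribute nothing. The second
  alternative therefore admits a test given by a log-ratio formula, whatever it decides on such
  samples.\<close>

lemma bayes_error_eq:
  assumes X: "finite X" "set_pmf p \<subseteq> X" "set_pmf q \<subseteq> X"
    and f: "\<And>xs. xs \<in> samples X n \<Longrightarrow>
      f xs = of_bool (\<pi> * pmf (replicate_pmf n p) xs \<le> (1 - \<pi>) * pmf (replicate_pmf n q) xs)
      \<or> pmf (replicate_pmf n p) xs = 0 \<and> pmf (replicate_pmf n q) xs = 0"
  shows "\<pi> * measure_pmf.expectation (replicate_pmf n p) f
     + (1 - \<pi>) * measure_pmf.expectation (replicate_pmf n q) (\<lambda>xs. 1 - f xs)
     = bayes_error X p q \<pi> n"
proof -
  have "bayes_error X p q \<pi> n = (\<Sum>xs\<in>samples X n. \<pi> * (pmf (replicate_pmf n p) xs * f xs)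
      + (1 - \<pi>) * (pmf (replicate_pmf n q) xs * (1 - f xs)))"
    unfolding bayes_error_def using f by (intro sum.cong) (force simp: min_def)+
  then show ?thesis
    using X by (simp add: expectation_replicate_pmf sum.distrib sum_distrib_left)
qed

lemma prob_replicate_pmf:
  assumes "finite X" "set_pmf p \<subseteq> X"
  shows "measure_pmf.prob (replicate_pmf n p) S
    = measure_pmf.expectation (replicate_pmf n p) (\<lambda>xs. of_bool (xs \<in> S))"
proof -
  have "measure_pmf.expectation (replicate_pmf n p) (\<lambda>xs. of_bool (xs \<in> S))
    = measure_pmf.expectation (replicate_pmf n p) (indicator S :: _ \<Rightarrow> real)"
    by (intro Bochner_Integration.integral_cong) (auto simp: indicator_def)
  then show ?thesis by simp
qed

text \<open>As \<open>p \<noteq> q\<close>, deciding for \<open>q\<close> is the same as rejecting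
  \<open>p\<close>, so both error terms are governed by one indicator; the likelihood ratio test
  attains the bound.\<close>

lemma n_B_eq_bayes:
  assumes X: "finite X" "set_pmf p \<subseteq> X" "set_pmf q \<subseteq> X" and "p \<noteq> q" and pi: "0 \<le> \<pi>" "\<pi> \<le> 1"
  shows "n_B X p q \<pi> \<delta> = Inf {enat n | n. bayes_error X p q \<pi> n \<le> \<delta>}"
proof -
  have err: "\<pi> * measure_pmf.prob (replicate_pmf n p) {xs. \<phi> xs \<noteq> p}
     + (1 - \<pi>) * measure_pmf.prob (replicate_pmf n q) {xs. \<phi> xs \<noteq> q}
     = \<pi> * measure_pmf.expectation (replicate_pmf n p) (\<lambda>xs. of_bool (\<phi> xs \<noteq> p))
     + (1 - \<pi>) * measure_pmf.expectation (replicate_pmf n q) (\<lambda>xs. 1 - of_bool (\<phi> xs \<noteq> p))"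
    if "\<phi> \<in> samples X n \<rightarrow> {p, q}" for \<phi> n
  proof -
    have "of_bool (\<phi> xs \<noteq> q) = (1 - of_bool (\<phi> xs \<noteq> p) :: real)" if "xs \<in> samples X n" for xs
      using \<open>\<phi> \<in> _\<close> that \<open>p \<noteq> q\<close> by (auto simp: Pi_def)
    then have "measure_pmf.expectation (replicate_pmf n q) (\<lambda>xs. of_bool (\<phi> xs \<noteq> q))
      = measure_pmf.expectation (replicate_pmf n q) (\<lambda>xs. 1 - of_bool (\<phi> xs \<noteq> p) :: real)"
      unfolding expectation_replicate_pmf[OF X(1,3)] by (intro sum.cong) auto
    then show ?thesis
      unfolding prob_replicate_pmf[OF X(1,2)] prob_replicate_pmf[OF X(1,3)] by simp
  qed
  have "(\<exists>\<phi>. \<phi> \<in> samples X n \<rightarrow> {p, q} \<and>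
     \<pi> * measure_pmf.prob (replicate_pmf n p) {xs. \<phi> xs \<noteq> p}
     + (1 - \<pi>) * measure_pmf.prob (replicate_pmf n q) {xs. \<phi> xs \<noteq> q} \<le> \<delta>)
     \<longleftrightarrow> bayes_error X p q \<pi> n \<le> \<delta>" for n
  proof
    assume "\<exists>\<phi>. \<phi> \<in> samples X n \<rightarrow> {p, q} \<and>
     \<pi> * measure_pmf.prob (replicate_pmf n p) {xs. \<phi> xs \<noteq> p}
     + (1 - \<pi>) * measure_pmf.prob (replicate_pmf n q) {xs. \<phi> xs \<noteq> q} \<le> \<delta>"
    then obtain \<phi> where \<phi>: "\<phi> \<in> samples X n \<rightarrow> {p, q}"
      "\<pi> * measure_pmf.prob (replicate_pmf n p) {xs. \<phi> xs \<noteq> p}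
     + (1 - \<pi>) * measure_pmf.prob (replicate_pmf n q) {xs. \<phi> xs \<noteq> q} \<le> \<delta>" by blast
    show "bayes_error X p q \<pi> n \<le> \<delta>"
      using bayes_error_le[OF X pi, of n "\<lambda>xs. of_bool (\<phi> xs \<noteq> p)"] err[OF \<phi>(1)] \<phi>(2) by simp
  next
    assume *: "bayes_error X p q \<pi> n \<le> \<delta>"
    define \<phi> where "\<phi> xs = (if \<pi> * pmf (replicate_pmf n p) xs \<le> (1 - \<pi>) * pmf (replicate_pmf n q) xs
      then q else p)" for xs
    have mem: "\<phi> \<in> samples X n \<rightarrow> {p, q}" by (auto simp: \<phi>_def)
    show "\<exists>\<phi>. \<phi> \<in> samples X n \<rightarrow> {p, q} \<and>
     \<pi> * measure_pmf.prob (replicate_pmf n p) {xs. \<phi> xs \<noteq> p}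
     + (1 - \<pi>) * measure_pmf.prob (replicate_pmf n q) {xs. \<phi> xs \<noteq> q} \<le> \<delta>"
      using mem err[OF mem] bayes_error_eq[OF X, of n "\<lambda>xs. of_bool (\<phi> xs \<noteq> p)" \<pi>] * \<open>p \<noteq> q\<close>
      by (intro exI[of _ \<phi>]) (simp add: \<phi>_def)
  qed
  then show ?thesis unfolding n_B_def by simp
qed

text \<open>This serves finiteness of the sample complexity. \<open>\<rho>\<close> is the
  Bhattacharyya coefficient, below 1 for distinct distributions by strict AM-GM; a minimum is at
  most a geometric mean, and the latter factorises over the samples into
  \<open>\<rho> ^ n\<close>.\<close>

lemma bayes_error_tendsto_0:
  assumes X: "finite X" "set_pmf p \<subseteq> X" "set_pmf q \<subseteq> X" and "p \<noteq> q" and pi: "0 \<le> \<pi>" "\<pi> \<le> 1"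
  shows "bayes_error X p q \<pi> \<longlonglongrightarrow> 0"
proof -
  define \<rho> where "\<rho> = (\<Sum>x\<in>X. sqrt (pmf p x * pmf q x))"
  have amgm: "sqrt (a * b) \<le> (a + b) / 2" if "0 \<le> a" "0 \<le> b" for a b :: real
    using arith_geo_mean_sqrt that by auto
  have "\<exists>x. pmf p x \<noteq> pmf q x"
    using \<open>p \<noteq> q\<close> pmf_eqI[of p q] by auto
  then obtain x where x: "pmf p x \<noteq> pmf q x" by blast
  then have xX: "x \<in> X" using X(2,3) by (metis pmf_eq_0_set_pmf subsetD)
  have strict: "sqrt (pmf p x * pmf q x) < (pmf p x + pmf q x) / 2"
  proof -
    have "pmf p x * pmf q x < ((pmf p x + pmf q x) / 2)\<^sup>2"
      using zero_less_power2[of "pmf p x - pmf q x"] x by (simp add: power2_eq_square field_simps)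
    then show ?thesis
      by (metis pmf_nonneg add_nonneg_nonneg divide_nonneg_nonneg real_less_lsqrt zero_le_numeral)
  qed
  have "\<rho> < (\<Sum>x\<in>X. (pmf p x + pmf q x) / 2)"
    unfolding \<rho>_def using X(1) amgm xX strict by (intro sum_strict_mono_ex1) auto
  also have "\<dots> = 1"
    using sum_pmf_eq_1[OF X(1,2)] sum_pmf_eq_1[OF X(1,3)]
    by (simp add: sum.distrib sum_divide_distrib[symmetric])
  finally have "\<rho> < 1" .
  moreover have "0 \<le> \<rho>" unfolding \<rho>_def by (intro sum_nonneg) simp
  ultimately have lim: "(\<lambda>n. \<rho> ^ n) \<longlonglongrightarrow> 0" by (intro LIMSEQ_power_zero) simp
  have sqrt_prod: "sqrt (prod_list (map (pmf p) xs) * prod_list (map (pmf q) xs))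
      = prod_list (map (\<lambda>x. sqrt (pmf p x * pmf q x)) xs)" for xs
    by (induction xs) (auto simp: real_sqrt_mult mult_ac)
  have min_le: "min a b \<le> sqrt (a' * b')" if "0 \<le> a" "0 \<le> b" "a \<le> a'" "b \<le> b'" for a b a' b' :: real
  proof (rule real_le_rsqrt)
    have "(min a b)\<^sup>2 \<le> a * b"
      unfolding power2_eq_square using that by (intro mult_mono) auto
    also have "\<dots> \<le> a' * b'" using that by (intro mult_mono) auto
    finally show "(min a b)\<^sup>2 \<le> a' * b'" .
  qed
  have "bayes_error X p q \<pi> n \<le> \<rho> ^ n" for n
  proof -
    have "bayes_error X p q \<pi> n
      \<le> (\<Sum>xs\<in>samples X n. sqrt (pmf (replicate_pmf n p) xs * pmf (replicate_pmf n q) xs))"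
      unfolding bayes_error_def using pi
      by (intro sum_mono min_le) (auto simp: mult_left_le_one_le)
    also have "\<dots> = (\<Sum>xs\<in>samples X n. prod_list (map (\<lambda>x. sqrt (pmf p x * pmf q x)) xs))"
      by (intro sum.cong) (auto simp: samples_def pmf_replicate_pmf sqrt_prod)
    finally show ?thesis by (simp add: sum_samples_prod[OF X(1)] \<rho>_def)
  qed
  moreover have "0 \<le> bayes_error X p q \<pi> n" for n
    unfolding bayes_error_def using pi by (intro sum_nonneg) auto
  ultimately show ?thesis
    by (intro tendsto_sandwich[OF _ _ tendsto_const lim] always_eventually) auto
qed

section \<open>Robust tests\<close>

lemma expectation_tv_le:
  fixes g :: "'a \<Rightarrow> real"
  assumes X: "finite X" "set_pmf p \<subseteq> X" "set_pmf p' \<subseteq> X"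
    and g: "\<And>x. x \<in> X \<Longrightarrow> lo \<le> g x \<and> g x \<le> hi"
  shows "measure_pmf.expectation p' g - measure_pmf.expectation p g \<le> (hi - lo) * tv X p p'"
proof -
  \<comment> \<open>Subtracting the midpoint is free because both pmfs have mass 1, and it leaves at
    most half the oscillation of \<open>g\<close>; this half is the factor in
    \<open>tv\<close>.\<close>
  define c where "c = (lo + hi) / 2"
  have "measure_pmf.expectation p' g - measure_pmf.expectation p g
    = (\<Sum>x\<in>X. (g x - c) * (pmf p' x - pmf p x))"
    using sum_pmf_eq_1[OF X(1,2)] sum_pmf_eq_1[OF X(1,3)]
    unfolding expectation_finite_support[OF X(1,2)] expectation_finite_support[OF X(1,3)]
    by (simp add: algebra_simps sum.distrib sum_subtractf flip: sum_distrib_left)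
  also have "\<dots> \<le> (\<Sum>x\<in>X. (hi - lo) / 2 * \<bar>pmf p x - pmf p' x\<bar>)"
  proof (intro sum_mono)
    fix x assume "x \<in> X"
    have "(g x - c) * (pmf p' x - pmf p x) \<le> \<bar>g x - c\<bar> * \<bar>pmf p x - pmf p' x\<bar>"
      by (metis abs_ge_self abs_minus_commute abs_mult)
    also have "\<bar>g x - c\<bar> \<le> (hi - lo) / 2"
      using g[OF \<open>x \<in> X\<close>] by (auto simp: c_def abs_if field_simps)
    finally show "(g x - c) * (pmf p' x - pmf p x) \<le> (hi - lo) / 2 * \<bar>pmf p x - pmf p' x\<bar>"
      by (simp add: mult_right_mono)
  qed
  finally show ?thesis by (simp add: tv_def sum_distrib_left)
qed

text \<open>The pmf \<open>p'\<close> arises from \<open>p\<close> by moving mass \<open>\<epsilon>\<close> from the minimisers to the maximisers of \<open>g\<close>;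
  no other pmf in the ball around \<open>p\<close> can do better.\<close>

lemma expectation_le_shifted:
  fixes g :: "'a \<Rightarrow> real"
  assumes X: "finite X" "set_pmf p \<subseteq> X" "set_pmf p' \<subseteq> X" "set_pmf p'' \<subseteq> X"
    and g: "\<And>x. x \<in> X \<Longrightarrow> lo \<le> g x \<and> g x \<le> hi"
    and shift: "\<And>x. x \<in> X \<Longrightarrow> pmf p' x = pmf p x + u x - d x"
    and u: "\<And>x. x \<in> X \<Longrightarrow> u x \<noteq> 0 \<Longrightarrow> g x = hi" "sum u X = \<epsilon>"
    and d: "\<And>x. x \<in> X \<Longrightarrow> d x \<noteq> 0 \<Longrightarrow> g x = lo" "sum d X = \<epsilon>"
    and "tv X p p'' \<le> \<epsilon>"
  shows "measure_pmf.expectation p'' g \<le> measure_pmf.expectation p' g"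
proof -
  have "X \<noteq> {}" using X(2) set_pmf_not_empty[of p] by auto
  then have "lo \<le> hi" using g by force
  have "measure_pmf.expectation p' g = measure_pmf.expectation p g + (\<Sum>x\<in>X. u x * g x) - (\<Sum>x\<in>X. d x * g x)"
    unfolding expectation_finite_support[OF X(1,2)] expectation_finite_support[OF X(1,3)]
    by (simp add: shift algebra_simps sum.distrib sum_subtractf)
  also have "(\<Sum>x\<in>X. u x * g x) = (\<Sum>x\<in>X. u x * hi)"
    using u(1) by (intro sum.cong) auto
  also have "(\<Sum>x\<in>X. d x * g x) = (\<Sum>x\<in>X. d x * lo)"
    using d(1) by (intro sum.cong) auto
  finally have "measure_pmf.expectation p' g = measure_pmf.expectation p g + (hi - lo) * \<epsilon>"
    using u(2) d(2) unfolding sum_distrib_right[symmetric] by (simp add: algebra_simps)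
  moreover have "(hi - lo) * tv X p p'' \<le> (hi - lo) * \<epsilon>"
    using \<open>lo \<le> hi\<close> assms(11) by (intro mult_left_mono) auto
  ultimately show ?thesis
    using expectation_tv_le[OF X(1,2,4), of lo g hi] g by simp
qed

text \<open>Condition on the first observation \<open>x\<close>: the induction hypothesis for the
  translate \<open>f (l x + _)\<close> exchanges the remaining ones, and the one-sample case for
  \<open>G (l x)\<close> exchanges the first. Hence \<open>f\<close> has to be arbitrary in the
  induction.\<close>

lemma expectation_replicate_le_shifted:
  fixes l :: "'a \<Rightarrow> real" and f :: "real \<Rightarrow> real"
  assumes X: "finite X" "set_pmf p \<subseteq> X" "set_pmf p' \<subseteq> X" "set_pmf p'' \<subseteq> X"
    and l: "\<And>x. x \<in> X \<Longrightarrow> lo \<le> l x \<and> l x \<le> hi"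
    and shift: "\<And>x. x \<in> X \<Longrightarrow> pmf p' x = pmf p x + u x - d x"
    and u: "\<And>x. x \<in> X \<Longrightarrow> u x \<noteq> 0 \<Longrightarrow> l x = hi" "sum u X = \<epsilon>"
    and d: "\<And>x. x \<in> X \<Longrightarrow> d x \<noteq> 0 \<Longrightarrow> l x = lo" "sum d X = \<epsilon>"
    and tv: "tv X p p'' \<le> \<epsilon>"
    and "mono f"
  shows "measure_pmf.expectation (replicate_pmf n p'') (\<lambda>xs. f (sum_list (map l xs)))
    \<le> measure_pmf.expectation (replicate_pmf n p') (\<lambda>xs. f (sum_list (map l xs)))"
  using \<open>mono f\<close>
proof (induction n arbitrary: f)
  case (Suc n)
  define G where "G y = measure_pmf.expectation (replicate_pmf n p') (\<lambda>xs. f (y + sum_list (map l xs)))" for y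
  have "G a \<le> G b" if "a \<le> b" for a b
    unfolding G_def using X Suc.prems that
    by (intro integral_mono integrable_measure_pmf_finite finite_set_replicate_pmf) (auto simp: mono_def)
  then have G: "mono G" by (rule monoI)
  have "measure_pmf.expectation (replicate_pmf (Suc n) p'') (\<lambda>xs. f (sum_list (map l xs)))
    = (\<Sum>x\<in>X. pmf p'' x * measure_pmf.expectation (replicate_pmf n p'') (\<lambda>xs. f (l x + sum_list (map l xs))))"
    using X by (simp add: expectation_replicate_pmf_Suc del: replicate_pmf.simps)
  also have "\<dots> \<le> (\<Sum>x\<in>X. pmf p'' x * G (l x))"
    unfolding G_def using Suc.prems by (intro sum_mono mult_left_mono Suc.IH) (auto simp: mono_def)
  also have "\<dots> = measure_pmf.expectation p'' (\<lambda>x. G (l x))"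
    using X by (simp add: expectation_finite_support)
  \<comment> \<open>A monotone \<open>G\<close> takes its extreme values at the ends of
    \<open>[lo, hi]\<close>, so \<open>u\<close> and \<open>d\<close> also sit on maximisers and
    minimisers of \<open>G (l x)\<close>.\<close>
  also have "\<dots> \<le> measure_pmf.expectation p' (\<lambda>x. G (l x))"
    using l G u d by (intro expectation_le_shifted[OF X _ shift _ u(2) _ d(2) tv, of "G lo" _ "G hi"])
      (auto simp: mono_def)
  also have "\<dots> = measure_pmf.expectation (replicate_pmf (Suc n) p') (\<lambda>xs. f (sum_list (map l xs)))"
    using X by (simp add: expectation_replicate_pmf_Suc expectation_finite_support G_def del: replicate_pmf.simps)
  finally show ?case .
qed simp

section \<open>Worst-case errors and the saddle point\<close>

lemma prob_bind_replicate_pmf: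
  assumes X: "finite X" "set_pmf p \<subseteq> X" and \<phi>: "\<And>xs. xs \<in> samples X n \<Longrightarrow> finite (set_pmf (\<phi> xs))"
  shows "measure_pmf.prob (bind_pmf (replicate_pmf n p) \<phi>) S
    = measure_pmf.expectation (replicate_pmf n p) (\<lambda>xs. measure_pmf.prob (\<phi> xs) S)"
proof -
  have "measure_pmf.prob (bind_pmf (replicate_pmf n p) \<phi>) S
     = measure_pmf.expectation (bind_pmf (replicate_pmf n p) \<phi>) (indicator S)" by simp
  also have "\<dots> = (\<Sum>xs\<in>samples X n. pmf (replicate_pmf n p) xs * measure_pmf.expectation (\<phi> xs) (indicator S))"
    using \<phi> by (subst pmf_expectation_bind[OF finite_samples[OF X(1)] _ set_replicate_pmf_subset[OF X(2)]]) auto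
  finally show ?thesis using X by (simp add: expectation_replicate_pmf)
qed

text \<open>The ball is open, but it contains the mixtures \<open>(1 - t) p + t p'\<close> with \<open>t < 1\<close>, whose
  \<open>n\<close>-fold products dominate \<open>t\<^sup>n\<close> times the product of \<open>p'\<close>.\<close>

lemma prob_le_SUP_tv_ball:
  assumes X: "finite X" "set_pmf p \<subseteq> X" "set_pmf p' \<subseteq> X" and "0 < \<epsilon>" and tv: "tv X p p' \<le> \<epsilon>"
    and \<phi>: "\<And>xs. xs \<in> samples X n \<Longrightarrow> finite (set_pmf (\<phi> xs))"
  shows "measure_pmf.prob (bind_pmf (replicate_pmf n p') \<phi>) S
    \<le> (SUP p'' \<in> tv_ball X p \<epsilon>. measure_pmf.prob (bind_pmf (replicate_pmf n p'') \<phi>) S)" (is "?P p' \<le> ?sup")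
proof -
  have le: "t ^ n * ?P p' \<le> ?sup" if t: "0 < t" "t < 1" for t
  proof -
    define mix where "mix = bind_pmf (bernoulli_pmf t) (\<lambda>b. if b then p' else p)"
    have pmf_mix: "pmf mix x = (1 - t) * pmf p x + t * pmf p' x" for x
      unfolding mix_def using t by (simp add: pmf_bind)
    have supp: "set_pmf mix \<subseteq> X"
      unfolding mix_def using X by (auto split: if_splits)
    have "tv X p mix = t * tv X p p'"
    proof -
      have "\<bar>pmf p x - pmf mix x\<bar> = t * \<bar>pmf p x - pmf p' x\<bar>" for x
      proof -
        have "pmf p x - pmf mix x = t * (pmf p x - pmf p' x)"
          by (simp add: pmf_mix algebra_simps)
        then show ?thesis using t by (simp add: abs_mult)
      qed
      then show ?thesis by (simp add: tv_def sum_distrib_left)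
    qed
    also have "\<dots> \<le> t * \<epsilon>" using t tv by simp
    also have "\<dots> < \<epsilon>" using t \<open>0 < \<epsilon>\<close> by simp
    finally have ball: "mix \<in> tv_ball X p \<epsilon>" using supp by (simp add: tv_ball_def)
    have "t ^ length xs * prod_list (map (pmf p') xs) \<le> prod_list (map (pmf mix) xs)" for xs
    proof (induction xs)
      case (Cons x xs)
      have "(t * pmf p' x) * (t ^ length xs * prod_list (map (pmf p') xs))
        \<le> pmf mix x * prod_list (map (pmf mix) xs)"
        
      proof (intro mult_mono Cons.IH)
        show "t * pmf p' x \<le> pmf mix x" using t by (simp add: pmf_mix)
        show "0 \<le> t ^ length xs * prod_list (map (pmf p') xs)"
          using t by (intro mult_nonneg_nonneg prod_list_nonneg) auto
      qed simp
      then show ?case by (simp add: mult_ac)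
    qed simp
    then have "t ^ n * pmf (replicate_pmf n p') xs \<le> pmf (replicate_pmf n mix) xs"
      if "xs \<in> samples X n" for xs
      using that by (auto simp: samples_def pmf_replicate_pmf)
    then have "(\<Sum>xs\<in>samples X n. t ^ n * pmf (replicate_pmf n p') xs * measure_pmf.prob (\<phi> xs) S)
      \<le> (\<Sum>xs\<in>samples X n. pmf (replicate_pmf n mix) xs * measure_pmf.prob (\<phi> xs) S)"
      by (intro sum_mono mult_right_mono) auto
    then have "t ^ n * ?P p' \<le> ?P mix"
      using X supp \<phi> by (simp add: prob_bind_replicate_pmf expectation_replicate_pmf sum_distrib_left mult_ac)
    also have "\<dots> \<le> ?sup"
      using ball by (intro cSUP_upper bdd_aboveI2[of _ _ 1]) auto
    finally show ?thesis .
  qed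
  \<comment> \<open>The supremum does not depend on \<open>t\<close>, so the factor
    \<open>t ^ n\<close> disappears in the limit from below.\<close>
  have "((\<lambda>t. t ^ n * ?P p') \<longlongrightarrow> 1 ^ n * ?P p') (at_left 1)"
    by (intro tendsto_intros)
  moreover have "eventually (\<lambda>t::real. t ^ n * ?P p' \<le> ?sup) (at_left 1)"
    using eventually_at_left_real[of 0 1] by (rule eventually_mono) (auto intro: le)
  ultimately show ?thesis
    by (auto intro: tendsto_upperbound)
qed

lemma sum_list_map_uminus: "sum_list (map (\<lambda>x. - f x) xs) = - sum_list (map f xs)"
  for f :: "'a \<Rightarrow> real"
  by (induction xs) auto

text \<open>\<open>(p', q')\<close> is a saddle point. The masses \<open>u\<close> and
  \<open>d\<close> are exchanged between the two distributions, so \<open>p' + q' = p + q\<close>;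
  \<open>u\<close> sits where the log-ratio \<open>l\<close> is largest and \<open>d\<close> where
  it is smallest. Any test does at least as badly on the balls as on the pair, and the likelihood
  ratio test does no worse.\<close>

lemma n_B_rob_eq_n_B:
  fixes p q p' q' :: "'a pmf" and l u d :: "'a \<Rightarrow> real"
  assumes X: "finite X" "set_pmf p \<subseteq> X" "set_pmf q \<subseteq> X" "set_pmf p' \<subseteq> X" "set_pmf q' \<subseteq> X"
    and "p \<noteq> q" "p' \<noteq> q'" "0 < \<epsilon>"
    and p': "\<And>x. x \<in> X \<Longrightarrow> pmf p' x = pmf p x + u x - d x"
    and q': "\<And>x. x \<in> X \<Longrightarrow> pmf q' x = pmf q x + d x - u x"
    and u: "\<And>x. x \<in> X \<Longrightarrow> 0 \<le> u x" "\<And>x. x \<in> X \<Longrightarrow> u x \<noteq> 0 \<Longrightarrow> l x = hi" "sum u X = \<epsilon>"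
    and d: "\<And>x. x \<in> X \<Longrightarrow> 0 \<le> d x" "\<And>x. x \<in> X \<Longrightarrow> d x \<noteq> 0 \<Longrightarrow> l x = lo" "sum d X = \<epsilon>"
    and l: "\<And>x. x \<in> X \<Longrightarrow> lo \<le> l x \<and> l x \<le> hi"
    and ratio: "\<And>x. x \<in> X \<Longrightarrow> pmf q' x = pmf p' x * exp (l x)"
    and pi: "0 < \<pi>" "\<pi> < 1" and "0 < \<delta>"
  shows "n_B_rob X p q \<pi> \<delta> \<epsilon> = n_B X p' q' \<pi> \<delta>" "n_B X p' q' \<pi> \<delta> \<noteq> \<infinity>"
proof -
  have tvp: "tv X p p' \<le> \<epsilon>" and tvq: "tv X q q' \<le> \<epsilon>"
  proof -
    have "(\<Sum>x\<in>X. \<bar>u x - d x\<bar>) \<le> (\<Sum>x\<in>X. u x + d x)"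
      using u(1) d(1) by (intro sum_mono) (auto simp: abs_le_iff add_increasing add_increasing2)
    then have *: "(\<Sum>x\<in>X. \<bar>u x - d x\<bar>) \<le> 2 * \<epsilon>" using u d by (simp add: sum.distrib)
    have "(\<Sum>x\<in>X. \<bar>pmf p x - pmf p' x\<bar>) = (\<Sum>x\<in>X. \<bar>u x - d x\<bar>)"
      using p' by (intro sum.cong) auto
    with * show "tv X p p' \<le> \<epsilon>" by (simp add: tv_def)
    have "(\<Sum>x\<in>X. \<bar>pmf q x - pmf q' x\<bar>) = (\<Sum>x\<in>X. \<bar>u x - d x\<bar>)"
      using q' by (intro sum.cong) auto
    with * show "tv X q q' \<le> \<epsilon>" by (simp add: tv_def)
  qed
  have "pmf (replicate_pmf n q') xs = pmf (replicate_pmf n p') xs * exp (sum_list (map l xs))"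
    if "xs \<in> samples X n" for xs n
  proof -
    have "prod_list (map (pmf q') xs) = prod_list (map (pmf p') xs) * exp (sum_list (map l xs))"
      if "set xs \<subseteq> X" for xs
      using that by (induction xs) (auto simp: ratio exp_add)
    with that show ?thesis by (auto simp: samples_def pmf_replicate_pmf)
  qed
  note product_ratio = this
  define err where "err n \<phi> = \<pi> * (SUP p'' \<in> tv_ball X p \<epsilon>.
            measure_pmf.prob (bind_pmf (replicate_pmf n p'') \<phi>) {h. h \<noteq> p})
     + (1 - \<pi>) * (SUP q'' \<in> tv_ball X q \<epsilon>.
            measure_pmf.prob (bind_pmf (replicate_pmf n q'') \<phi>) {h. h \<noteq> q})"
    for n and \<phi> :: "'a list \<Rightarrow> 'a pmf pmf"
  have lower: "bayes_error X p' q' \<pi> n \<le> err n \<phi>"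
    if \<phi>: "\<forall>xs \<in> samples X n. set_pmf (\<phi> xs) \<subseteq> {p, q}" for n \<phi>
  proof -
    have fin: "\<And>xs. xs \<in> samples X n \<Longrightarrow> finite (set_pmf (\<phi> xs))"
      using \<phi> by (meson finite.emptyI finite.insertI finite_subset)
    have compl: "measure_pmf.prob (\<phi> xs) {h. h \<noteq> q} = 1 - measure_pmf.prob (\<phi> xs) {h. h \<noteq> p}"
      if "xs \<in> samples X n" for xs
    proof -
      have "measure_pmf.prob (\<phi> xs) {h. h \<noteq> q} = measure_pmf.prob (\<phi> xs) (- {h. h \<noteq> p})"
        using \<phi> that \<open>p \<noteq> q\<close> by (intro measure_pmf.finite_measure_eq_AE) (auto simp: AE_measure_pmf_iff)
      then show ?thesis by (simp add: measure_pmf.prob_compl[of "{h. h \<noteq> p}", simplified] Compl_eq_Diff_UNIV)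
    qed
    have "bayes_error X p' q' \<pi> n \<le> \<pi> * measure_pmf.expectation (replicate_pmf n p') (\<lambda>xs. measure_pmf.prob (\<phi> xs) {h. h \<noteq> p})
       + (1 - \<pi>) * measure_pmf.expectation (replicate_pmf n q') (\<lambda>xs. 1 - measure_pmf.prob (\<phi> xs) {h. h \<noteq> p})"
      using X pi by (intro bayes_error_le) auto
    also have "measure_pmf.expectation (replicate_pmf n q') (\<lambda>xs. 1 - measure_pmf.prob (\<phi> xs) {h. h \<noteq> p})
      = measure_pmf.expectation (replicate_pmf n q') (\<lambda>xs. measure_pmf.prob (\<phi> xs) {h. h \<noteq> q})"
      using X compl by (simp add: expectation_replicate_pmf cong: sum.cong)
    also have "\<pi> * measure_pmf.expectation (replicate_pmf n p') (\<lambda>xs. measure_pmf.prob (\<phi> xs) {h. h \<noteq> p})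
       + (1 - \<pi>) * \<dots> \<le> err n \<phi>"
      unfolding err_def
      using X pi fin \<open>0 < \<epsilon>\<close> tvp tvq
      by (intro add_mono mult_left_mono)
        (simp_all add: prob_bind_replicate_pmf[symmetric] prob_le_SUP_tv_ball)
    finally show ?thesis .
  qed
  have upper: "\<exists>\<phi>. (\<forall>xs \<in> samples X n. set_pmf (\<phi> xs) \<subseteq> {p, q}) \<and> err n \<phi> \<le> bayes_error X p' q' \<pi> n" for n
  proof -
    \<comment> \<open>The test sees a sample only through its summed log-ratio, and its rejection
      probability is monotone in that sum, as the extremality lemma requires.\<close>
    define f :: "real \<Rightarrow> real" where "f y = of_bool (\<pi> \<le> (1 - \<pi>) * exp y)" for y
    define \<phi> where "\<phi> xs = return_pmf (if \<pi> \<le> (1 - \<pi>) * exp (sum_list (map l xs)) then q else p)" for xs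
    have f: "mono f"
    proof (rule monoI)
      fix a b :: real assume "a \<le> b"
      then have "(1 - \<pi>) * exp a \<le> (1 - \<pi>) * exp b" using pi by (intro mult_left_mono) auto
      then show "f a \<le> f b" by (auto simp: f_def)
    qed
    then have f': "mono (\<lambda>y. 1 - f (- y))" by (auto simp: mono_def)
    have fin: "finite (set_pmf (\<phi> xs))" for xs by (simp add: \<phi>_def)
    have ne: "tv_ball X p \<epsilon> \<noteq> {}" "tv_ball X q \<epsilon> \<noteq> {}"
      using X \<open>0 < \<epsilon>\<close> by (auto simp: tv_ball_def tv_def)
    have "(SUP p'' \<in> tv_ball X p \<epsilon>. measure_pmf.prob (bind_pmf (replicate_pmf n p'') \<phi>) {h. h \<noteq> p})
      \<le> measure_pmf.expectation (replicate_pmf n p') (\<lambda>xs. f (sum_list (map l xs)))"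
    proof (rule cSUP_least[OF ne(1)])
      fix p'' assume "p'' \<in> tv_ball X p \<epsilon>"
      then have p'': "set_pmf p'' \<subseteq> X" "tv X p p'' \<le> \<epsilon>" by (auto simp: tv_ball_def)
      have le: "measure_pmf.expectation (replicate_pmf n p'') (\<lambda>xs. f (sum_list (map l xs)))
        \<le> measure_pmf.expectation (replicate_pmf n p') (\<lambda>xs. f (sum_list (map l xs)))"
        using l u d by (intro expectation_replicate_le_shifted[OF X(1,2,4) p''(1) _ p' _ u(3) _ d(3) p''(2) f,
            where lo = lo and hi = hi]) auto
      have "measure_pmf.prob (\<phi> xs) {h. h \<noteq> p} = f (sum_list (map l xs))" for xs
        using \<open>p \<noteq> q\<close> by (simp add: \<phi>_def f_def)
      then show "measure_pmf.prob (bind_pmf (replicate_pmf n p'') \<phi>) {h. h \<noteq> p}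
        \<le> measure_pmf.expectation (replicate_pmf n p') (\<lambda>xs. f (sum_list (map l xs)))"
        using le by (simp add: prob_bind_replicate_pmf[OF X(1) p''(1) fin])
    qed
    moreover have "(SUP q'' \<in> tv_ball X q \<epsilon>. measure_pmf.prob (bind_pmf (replicate_pmf n q'') \<phi>) {h. h \<noteq> q})
      \<le> measure_pmf.expectation (replicate_pmf n q') (\<lambda>xs. 1 - f (sum_list (map l xs)))"
    proof (rule cSUP_least[OF ne(2)])
      fix q'' assume "q'' \<in> tv_ball X q \<epsilon>"
      then have q'': "set_pmf q'' \<subseteq> X" "tv X q q'' \<le> \<epsilon>" by (auto simp: tv_ball_def)
      \<comment> \<open>Around \<open>q\<close> mass moves in the opposite direction, so the lemma
        is applied to \<open>- l\<close>, with \<open>u\<close> and \<open>d\<close> exchanged;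
        \<open>1 - f (- y)\<close> is again increasing in \<open>y\<close>.\<close>
      have le: "measure_pmf.expectation (replicate_pmf n q'') (\<lambda>xs. 1 - f (- sum_list (map (\<lambda>x. - l x) xs)))
        \<le> measure_pmf.expectation (replicate_pmf n q') (\<lambda>xs. 1 - f (- sum_list (map (\<lambda>x. - l x) xs)))"
        using l u d by (intro expectation_replicate_le_shifted[OF X(1,3,5) q''(1) _ q' _ d(3) _ u(3) q''(2) f',
            where lo = "- hi" and hi = "- lo"]) auto
      have "measure_pmf.prob (\<phi> xs) {h. h \<noteq> q} = 1 - f (sum_list (map l xs))" for xs
        using \<open>p \<noteq> q\<close> by (simp add: \<phi>_def f_def)
      then show "measure_pmf.prob (bind_pmf (replicate_pmf n q'') \<phi>) {h. h \<noteq> q}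
        \<le> measure_pmf.expectation (replicate_pmf n q') (\<lambda>xs. 1 - f (sum_list (map l xs)))"
        using le by (simp add: prob_bind_replicate_pmf[OF X(1) q''(1) fin] sum_list_map_uminus)
    qed
    ultimately have "err n \<phi> \<le> \<pi> * measure_pmf.expectation (replicate_pmf n p') (\<lambda>xs. f (sum_list (map l xs)))
       + (1 - \<pi>) * measure_pmf.expectation (replicate_pmf n q') (\<lambda>xs. 1 - f (sum_list (map l xs)))"
      unfolding err_def using pi by (intro add_mono mult_left_mono) auto
    also have "\<dots> = bayes_error X p' q' \<pi> n"
    proof (rule bayes_error_eq[OF X(1,4,5)])
      fix xs assume "xs \<in> samples X n"
      then have *: "pmf (replicate_pmf n q') xs = pmf (replicate_pmf n p') xs * exp (sum_list (map l xs))"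
        by (rule product_ratio)
      show "f (sum_list (map l xs))
          = of_bool (\<pi> * pmf (replicate_pmf n p') xs \<le> (1 - \<pi>) * pmf (replicate_pmf n q') xs)
        \<or> pmf (replicate_pmf n p') xs = 0 \<and> pmf (replicate_pmf n q') xs = 0"
      proof (cases "pmf (replicate_pmf n p') xs = 0")
        case False
        then have "0 < pmf (replicate_pmf n p') xs" by (simp add: order_less_le)
        then show ?thesis by (simp add: * f_def mult.left_commute[of _ "pmf _ _"] mult.commute[of \<pi>])
      qed (simp add: *)
    qed
    finally show ?thesis by (intro exI[of _ \<phi>]) (auto simp: \<phi>_def)
  qed
  have "(\<exists>\<phi>. (\<forall>xs \<in> samples X n. set_pmf (\<phi> xs) \<subseteq> {p, q}) \<and> err n \<phi> \<le> \<delta>) \<longleftrightarrow> bayes_error X p' q' \<pi> n \<le> \<delta>" for n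
    using lower upper order_trans by meson
  then show "n_B_rob X p q \<pi> \<delta> \<epsilon> = n_B X p' q' \<pi> \<delta>"
    using n_B_eq_bayes[OF X(1,4,5) \<open>p' \<noteq> q'\<close>, of \<pi> \<delta>] pi unfolding n_B_rob_def err_def by simp
  have "eventually (\<lambda>n. bayes_error X p' q' \<pi> n < \<delta>) sequentially"
    using bayes_error_tendsto_0[OF X(1,4,5) \<open>p' \<noteq> q'\<close>, of \<pi>] pi \<open>0 < \<delta>\<close> order_tendstoD(2) by auto
  then obtain n where "bayes_error X p' q' \<pi> n \<le> \<delta>"
    using eventually_happens by (metis less_imp_le sequentially_bot)
  then have "n_B X p' q' \<pi> \<delta> \<le> enat n"
    using n_B_eq_bayes[OF X(1,4,5) \<open>p' \<noteq> q'\<close>, of \<pi> \<delta>] pi by (auto intro: Inf_lower)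
  then obtain m where "n_B X p' q' \<pi> \<delta> = enat m" using enat_ile by blast
  then show "n_B X p' q' \<pi> \<delta> \<noteq> \<infinity>" by simp
qed

section \<open>The least favourable pair\<close>

text \<open>\<open>sel_sum A B j f n\<close> restricts the sum of \<open>f\<close> to the indices \<open>i\<close> with
  \<open>A i / (A i + B i) \<le> A j / (A j + B j)\<close>. The comparison is cross-multiplied, so that an index
  \<open>j\<close> with \<open>A j = B j = 0\<close> selects everything.\<close>

definition sel_sum :: "(nat \<Rightarrow> real) \<Rightarrow> (nat \<Rightarrow> real) \<Rightarrow> nat \<Rightarrow> (nat \<Rightarrow> real) \<Rightarrow> nat \<Rightarrow> real" where
  "sel_sum A B j f n = (\<Sum>i<n. if A j * B i < A i * B j then 0 else f i)"

text \<open>With \<open>U\<close> the set selected by \<open>j\<close> and \<open>m = A + B\<close>,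
  this is the root \<open>s\<close> of \<open>s * m(U) - A(U) = e\<close>.\<close>

definition level :: "(nat \<Rightarrow> real) \<Rightarrow> (nat \<Rightarrow> real) \<Rightarrow> real \<Rightarrow> nat \<Rightarrow> nat \<Rightarrow> real" where
  "level A B e k j = (e + sel_sum A B j A k) / sel_sum A B j (\<lambda>i. A i + B i) k"

text \<open>The start value 1 does not survive the minimum over all \<open>k\<close> levels, which
  turns out to be below 1/2, and it caps the intermediate values, which helps with their bit
  sizes.\<close>

fun min_level :: "(nat \<Rightarrow> real) \<Rightarrow> (nat \<Rightarrow> real) \<Rightarrow> real \<Rightarrow> nat \<Rightarrow> nat \<Rightarrow> real" where
  "min_level A B e k 0 = 1"
| "min_level A B e k (Suc j) = min (level A B e k j) (min_level A B e k j)"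

lemma min_level_le: "j < n \<Longrightarrow> min_level A B e k n \<le> level A B e k j"
  by (induction n) (auto simp: less_Suc_eq min_le_iff_disj)

lemma min_level_cases: "min_level A B e k n = 1 \<or> (\<exists>j<n. min_level A B e k n = level A B e k j)"
  by (induction n) (auto simp: min_def less_Suc_eq)

text \<open>Guards the division in \<open>level\<close>: an index with mass selects itself, and one
  without mass selects everything, with total 2.\<close>

lemma sel_sum_pos:
  assumes nonneg: "\<And>i. i < k \<Longrightarrow> 0 \<le> A i" "\<And>i. i < k \<Longrightarrow> 0 \<le> B i"
    and sums: "sum A {..<k} = (1::real)" "sum B {..<k} = 1" and "j < k"
  shows "0 < sel_sum A B j (\<lambda>i. A i + B i) k"
proof (cases "A j + B j = 0")
  case True
  then have "A j = 0" "B j = 0" using nonneg[OF \<open>j < k\<close>] by auto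
  then have "sel_sum A B j (\<lambda>i. A i + B i) k = 2"
    using sums by (simp add: sel_sum_def sum.distrib)
  then show ?thesis by simp
next
  case False
  then have "0 < A j + B j" using nonneg[OF \<open>j < k\<close>] by auto
  then show ?thesis
    unfolding sel_sum_def using \<open>j < k\<close> nonneg
    by (intro sum_pos2[of _ j]) (auto simp: mult.commute)
qed

text \<open>The excess \<open>\<Sum>i. max 0 (s * (A i + B i) - A i)\<close> is the maximum of
  \<open>\<Sum>i\<in>U. s * (A i + B i) - A i\<close> over all \<open>U\<close>, attained at a sublevel set of \<open>A i / (A i + B i)\<close>.
  Hence it is at most \<open>e\<close> iff \<open>s\<close> is at most the level of every \<open>j\<close>.\<close>

lemma min_level_excess:
  fixes A B :: "nat \<Rightarrow> real" and e :: real
  assumes nonneg: "\<And>i. i < k \<Longrightarrow> 0 \<le> A i" "\<And>i. i < k \<Longrightarrow> 0 \<le> B i"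
    and sums: "sum A {..<k} = 1" "sum B {..<k} = 1"
    and e: "0 < e" "2 * e < (\<Sum>i<k. max 0 (B i - A i))"
  defines "s \<equiv> min_level A B e k k"
  shows "(\<Sum>i<k. max 0 (s * (A i + B i) - A i)) = e" "0 < s" "s < 1 / 2"
proof -
  let ?excess = "\<lambda>j. sel_sum A B j (\<lambda>i. s * (A i + B i) - A i) k"
  have pos: "0 < sel_sum A B j (\<lambda>i. A i + B i) k" if "j < k" for j
    using sel_sum_pos[of k A B j] nonneg sums that by blast
  have sel_excess: "?excess j = s * sel_sum A B j (\<lambda>i. A i + B i) k - sel_sum A B j A k" for j
    unfolding sel_sum_def sum_distrib_left sum_subtractf[symmetric] by (intro sum.cong) auto
  have sel_le: "?excess j \<le> (\<Sum>i<k. max 0 (s * (A i + B i) - A i))" for j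
    unfolding sel_sum_def by (intro sum_mono) auto
  have sel_nonneg: "0 \<le> sel_sum A B j A k" for j
    unfolding sel_sum_def using nonneg by (intro sum_nonneg) auto
  have level_pos: "0 < level A B e k j" if "j < k" for j
    unfolding level_def using e(1) sel_nonneg[of j] pos[OF that] by simp
  show "0 < s"
    using min_level_cases[of A B e k k] level_pos by (auto simp: s_def)
  have upper: "(\<Sum>i<k. max 0 (s * (A i + B i) - A i)) \<le> e"
  proof (cases "\<exists>i<k. A i < s * (A i + B i)")
    case False
    then have "(\<Sum>i<k. max 0 (s * (A i + B i) - A i)) = 0" by (intro sum.neutral) (auto simp: max_def)
    then show ?thesis using e by simp
  next
    case True
    \<comment> \<open>The points where the clip at \<open>s\<close> is active. The index of largest
      ratio in \<open>U\<close> selects exactly \<open>U\<close>, up to points without mass, whose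
      terms vanish.\<close>
    define U where "U = {i\<in>{..<k}. A i < s * (A i + B i)}"
    have U: "finite U" "U \<noteq> {}" using True by (auto simp: U_def)
    define t where "t i = A i / (A i + B i)" for i
    obtain j where j: "j \<in> U" "\<And>i. i \<in> U \<Longrightarrow> t i \<le> t j"
    proof -
      have "Max (t ` U) \<in> t ` U" using U by (intro Max_in) auto
      then show ?thesis using that U by (metis (no_types, lifting) Max_ge finite_imageI imageE imageI)
    qed
    have mpos: "0 < A i + B i" if "i \<in> U" for i
    proof -
      have "0 \<le> A i" "0 \<le> B i" "A i < s * (A i + B i)" using that nonneg[of i] by (auto simp: U_def)
      then show ?thesis using \<open>0 < s\<close> zero_less_mult_pos[of s "A i + B i"] by linarith
    qed
    have cross: "t i \<le> t j \<longleftrightarrow> \<not> A j * B i < A i * B j" if "0 < A i + B i" for i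
      unfolding t_def using that mpos[OF j(1)] by (simp add: field_simps) auto
    have "(\<Sum>i<k. max 0 (s * (A i + B i) - A i)) = ?excess j"
      unfolding sel_sum_def
    proof (intro sum.cong refl)
      fix i assume i: "i \<in> {..<k}"
      show "max 0 (s * (A i + B i) - A i) = (if A j * B i < A i * B j then 0 else s * (A i + B i) - A i)"
      proof (cases "0 < A i + B i")
        case True
        have "i \<in> U" if "t i \<le> t j"
        proof -
          have "t j < s" using j(1) mpos[OF j(1)] by (simp add: U_def t_def field_simps)
          with that have "t i < s" by simp
          with True i show ?thesis by (simp add: U_def t_def pos_divide_less_eq)
        qed
        then have "i \<in> U \<longleftrightarrow> \<not> A j * B i < A i * B j" using cross[OF True] j(2) by blast
        then show ?thesis using i by (auto simp: U_def max_def)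
      next
        case False
        then have "A i = 0" "B i = 0" using nonneg[of i] i by auto
        then show ?thesis by simp
      qed
    qed
    also have "\<dots> \<le> e"
    proof -
      have "j < k" using j(1) by (simp add: U_def)
      have "s \<le> level A B e k j" unfolding s_def by (rule min_level_le[OF \<open>j < k\<close>])
      then show ?thesis using pos[OF \<open>j < k\<close>] unfolding sel_excess by (simp add: level_def pos_le_divide_eq)
    qed
    finally show ?thesis .
  qed
  \<comment> \<open>At level 1/2 a point has excess \<open>max 0 (B i - A i) / 2\<close>. A level of
    at least 1/2 would thus have a total excess above \<open>e\<close>.\<close>
  show "s < 1 / 2"
  proof (rule ccontr)
    assume "\<not> s < 1 / 2"
    then have "(\<Sum>i<k. max 0 (B i - A i) / 2) \<le> (\<Sum>i<k. max 0 (s * (A i + B i) - A i))"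
    proof (intro sum_mono)
      fix i assume "i \<in> {..<k}"
      then have "1 / 2 * (A i + B i) \<le> s * (A i + B i)"
        using nonneg[of i] \<open>\<not> s < 1 / 2\<close> by (intro mult_right_mono) auto
      then show "max 0 (B i - A i) / 2 \<le> max 0 (s * (A i + B i) - A i)"
        by (simp add: max_def field_simps)
    qed
    with upper e(2) show False by (simp add: sum_divide_distrib[symmetric])
  qed
  \<comment> \<open>Being below 1/2, \<open>s\<close> is not the start value 1, so it is the level
    of some \<open>j\<close>; the set selected by that \<open>j\<close> has excess exactly
    \<open>e\<close>, which gives the other inequality.\<close>
  then obtain j where j: "j < k" "s = level A B e k j"
    using min_level_cases[of A B e k k] by (auto simp: s_def)
  have "?excess j = e"
    using pos[OF j(1)] unfolding sel_excess by (simp add: j(2) level_def)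
  with upper sel_le[of j] show "(\<Sum>i<k. max 0 (s * (A i + B i) - A i)) = e" by simp
qed

section \<open>The clipped pair as distributions\<close>

lemma pmf_of_weights:
  fixes f :: "'a \<Rightarrow> real"
  assumes "finite X" "\<And>x. x \<in> X \<Longrightarrow> 0 \<le> f x" "sum f X = 1"
  obtains p where "set_pmf p \<subseteq> X" "\<And>x. x \<in> X \<Longrightarrow> pmf p x = f x"
proof -
  define g where "g x = (if x \<in> X then f x else 0)" for x
  have "(\<integral>\<^sup>+ x. ennreal (g x) \<partial>count_space UNIV) = (\<Sum>x\<in>X. ennreal (g x))"
    by (rule nn_integral_count_space'[OF assms(1)]) (auto simp: g_def)
  also have "\<dots> = ennreal (sum f X)"
    using assms(2) by (simp add: g_def sum_ennreal)
  finally have *: "(\<integral>\<^sup>+ x. ennreal (g x) \<partial>count_space UNIV) = 1" using assms(3) by simp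
  have nn: "\<And>x. 0 \<le> g x" using assms(2) by (simp add: g_def)
  show thesis
  proof (rule that)
    show "set_pmf (embed_pmf g) \<subseteq> X"
      unfolding set_embed_pmf[OF nn *] by (auto simp: g_def split: if_splits)
    show "pmf (embed_pmf g) x = f x" if "x \<in> X" for x
      using that by (simp add: pmf_embed_pmf[OF nn *] g_def)
  qed
qed

lemma tv_eq_sum_max:
  assumes X: "finite X" "set_pmf p \<subseteq> X" "set_pmf q \<subseteq> X"
  shows "tv X p q = (\<Sum>x\<in>X. max 0 (pmf p x - pmf q x))"
proof -
  have "(\<Sum>x\<in>X. \<bar>pmf p x - pmf q x\<bar>)
    = (\<Sum>x\<in>X. 2 * max 0 (pmf p x - pmf q x) - (pmf p x - pmf q x))"
    by (intro sum.cong) (auto simp: max_def)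
  also have "\<dots> = 2 * (\<Sum>x\<in>X. max 0 (pmf p x - pmf q x))"
    using sum_pmf_eq_1[OF X(1,2)] sum_pmf_eq_1[OF X(1,3)] by (simp add: sum_subtractf sum_distrib_left)
  finally show ?thesis by (simp add: tv_def)
qed

lemma tv_commute: "tv X p q = tv X q p"
  by (simp add: tv_def abs_minus_commute)

text \<open>The least favourable pair at a point with masses \<open>x\<close> and \<open>y\<close>: the ratio \<open>y : x + y\<close> is
  clipped to the interval \<open>[s, 1 - r]\<close>.\<close>

definition out_p :: "real \<Rightarrow> real \<Rightarrow> real \<Rightarrow> real \<Rightarrow> real" where
  "out_p s r x y = (if y < s * (x + y) then x + y - s * (x + y) else if x < r * (x + y) then r * (x + y) else x)"

definition out_q :: "real \<Rightarrow> real \<Rightarrow> real \<Rightarrow> real \<Rightarrow> real" where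
  "out_q s r x y = (if y < s * (x + y) then s * (x + y) else if x < r * (x + y) then x + y - r * (x + y) else y)"

lemma least_favourable_pair:
  fixes p q :: "nat pmf"
  assumes supp: "set_pmf p \<subseteq> {..<k}" "set_pmf q \<subseteq> {..<k}" and e: "0 < \<epsilon>" "\<epsilon> < tv {..<k} p q / 2"
  defines "s \<equiv> min_level (pmf q) (pmf p) \<epsilon> k k" and "r \<equiv> min_level (pmf p) (pmf q) \<epsilon> k k"
  obtains p' q' where "set_pmf p' \<subseteq> {..<k}" "set_pmf q' \<subseteq> {..<k}"
    "\<And>i. i < k \<Longrightarrow> pmf p' i = out_p s r (pmf p i) (pmf q i)"
    "\<And>i. i < k \<Longrightarrow> pmf q' i = out_q s r (pmf p i) (pmf q i)"
    "\<And>\<pi> \<delta>. 0 < \<pi> \<Longrightarrow> \<pi> < 1 \<Longrightarrow> 0 < \<delta> \<Longrightarrow>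
       n_B_rob {..<k} p q \<pi> \<delta> \<epsilon> = n_B {..<k} p' q' \<pi> \<delta> \<and> n_B {..<k} p' q' \<pi> \<delta> \<noteq> \<infinity>"
proof -
  let ?m = "\<lambda>i. pmf p i + pmf q i"
  have sums: "sum (pmf p) {..<k} = 1" "sum (pmf q) {..<k} = 1"
    using supp by (auto intro: sum_pmf_eq_1)
  have "2 * \<epsilon> < (\<Sum>i<k. max 0 (pmf p i - pmf q i))" "2 * \<epsilon> < (\<Sum>i<k. max 0 (pmf q i - pmf p i))"
    using e(2) supp tv_eq_sum_max[of "{..<k}" p q] tv_eq_sum_max[of "{..<k}" q p] tv_commute[of _ p q] by auto
  then have s: "(\<Sum>i<k. max 0 (s * ?m i - pmf q i)) = \<epsilon>" "0 < s" "s < 1 / 2"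
    and r: "(\<Sum>i<k. max 0 (r * ?m i - pmf p i)) = \<epsilon>" "0 < r" "r < 1 / 2"
    using min_level_excess[of k "pmf q" "pmf p" \<epsilon>] min_level_excess[of k "pmf p" "pmf q" \<epsilon>] sums e(1)
    unfolding s_def r_def by (simp_all add: add.commute)
  define d where "d i = max 0 (s * ?m i - pmf q i)" for i
  define u where "u i = max 0 (r * ?m i - pmf p i)" for i
  \<comment> \<open>Because \<open>s + r < 1\<close>, no point is clipped at both ends. This makes
    the nested conditionals agree with moving \<open>u\<close> and \<open>d\<close>
    independently.\<close>
  have excl: "pmf p i \<ge> r * ?m i" if "pmf q i < s * ?m i" for i
  proof -
    have "(s + r) * ?m i \<le> 1 * ?m i" using s r by (intro mult_right_mono) auto
    then show ?thesis using that by (simp add: algebra_simps)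
  qed
  have sm: "s * ?m i \<le> 1 / 2 * ?m i" "r * ?m i \<le> 1 / 2 * ?m i" "0 \<le> s * ?m i" "0 \<le> r * ?m i" for i
    using s r mult_right_mono[of s "1 / 2" "?m i"] mult_right_mono[of r "1 / 2" "?m i"] by simp_all
  define P where "P i = (if pmf q i < s * ?m i then ?m i - s * ?m i else if pmf p i < r * ?m i then r * ?m i else pmf p i)" for i
  define Q where "Q i = (if pmf q i < s * ?m i then s * ?m i else if pmf p i < r * ?m i then ?m i - r * ?m i else pmf q i)" for i
  have PQ: "P i = pmf p i + u i - d i" "Q i = pmf q i + d i - u i" for i
    using excl[of i] by (auto simp: P_def Q_def u_def d_def)
  have nonneg: "0 \<le> P i" "0 \<le> Q i" for i
  proof -
    have half: "0 \<le> m - x" if "x \<le> 1 / 2 * m" "0 \<le> m" for x m :: real using that by simp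
    have "0 \<le> ?m i - s * ?m i" "0 \<le> ?m i - r * ?m i"
      by (rule half[OF sm(1)] half[OF sm(2)], simp)+
    then show "0 \<le> P i" "0 \<le> Q i"
      using sm(3,4)[of i] unfolding P_def Q_def by (simp_all only: pmf_nonneg simp_thms split: if_split)
  qed
  have sumPQ: "sum P {..<k} = 1" "sum Q {..<k} = 1"
    unfolding PQ using sums s(1) r(1) by (auto simp: sum.distrib sum_subtractf u_def d_def)
  obtain p' where p': "set_pmf p' \<subseteq> {..<k}" "\<And>i. i < k \<Longrightarrow> pmf p' i = P i"
    using pmf_of_weights[of "{..<k}" P] nonneg sumPQ by auto
  obtain q' where q': "set_pmf q' \<subseteq> {..<k}" "\<And>i. i < k \<Longrightarrow> pmf q' i = Q i"
    using pmf_of_weights[of "{..<k}" Q] nonneg sumPQ by auto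
  \<comment> \<open>A positive \<open>\<epsilon>\<close> forces some point to be clipped at
    \<open>s\<close>; there the new \<open>q\<close> mass is below half of \<open>?m i\<close> and
    the new \<open>p\<close> mass above it.\<close>
  have "\<exists>i<k. pmf q i < s * ?m i"
  proof (rule ccontr)
    assume "\<not> ?thesis"
    then have "(\<Sum>i<k. max 0 (s * ?m i - pmf q i)) = 0" by (intro sum.neutral) auto
    with s(1) e(1) show False by simp
  qed
  then obtain i where i: "i < k" "pmf q i < s * ?m i" by blast
  have "pmf q' i < pmf p' i"
  proof -
    have "0 < ?m i" using i(2) s(2) pmf_nonneg[of q i] zero_less_mult_pos[of s "?m i"] by linarith
    then have "s * ?m i < 1 / 2 * ?m i" using s(3) by (intro mult_strict_right_mono) auto
    then show ?thesis using i p' q' by (simp add: P_def Q_def)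
  qed
  then have "p' \<noteq> q'" by auto
  have "p \<noteq> q" using e by (auto simp: tv_def)
  \<comment> \<open>At clipped points the new masses are in the ratio \<open>s / (1 - s)\<close> or
    \<open>(1 - r) / r\<close>, the extreme likelihood ratios.\<close>
  define lo where "lo = ln (s / (1 - s))"
  define hi where "hi = ln ((1 - r) / r)"
  \<comment> \<open>Where \<open>?m i = 0\<close> both new masses vanish, so any value satisfies the
    ratio equation; \<open>lo\<close> stays within the bounds and avoids
    \<open>ln (0 / 0)\<close>.\<close>
  define l where "l i = (if d i \<noteq> 0 \<or> ?m i = 0 then lo else if u i \<noteq> 0 then hi else ln (pmf q i / pmf p i))" for i
  have "s / (1 - s) \<le> 1" "1 \<le> (1 - r) / r" using s r by (auto simp: field_simps)
  then have "lo \<le> 0" "0 \<le> hi" using s r by (auto simp: lo_def hi_def)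
  have exps: "exp lo = s / (1 - s)" "exp hi = (1 - r) / r"
    using s r by (auto simp: lo_def hi_def)
  \<comment> \<open>Positive \<open>s\<close> and \<open>r\<close> ensure that an unclipped point
    with mass has mass under both distributions, so the logarithm in \<open>l\<close> is
    genuine.\<close>
  have mid: "0 < pmf p i" "0 < pmf q i" "s * pmf p i \<le> (1 - s) * pmf q i" "r * pmf q i \<le> (1 - r) * pmf p i"
    if "d i = 0" "u i = 0" "?m i \<noteq> 0" for i
  proof -
    have "0 < ?m i" using that(3) pmf_nonneg[of p i] pmf_nonneg[of q i] by linarith
    then have "0 < s * ?m i" "0 < r * ?m i" using s r by auto
    moreover have "s * ?m i \<le> pmf q i" "r * ?m i \<le> pmf p i" using that(1,2) by (auto simp: u_def d_def max_def split: if_splits)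
    ultimately show "0 < pmf p i" "0 < pmf q i" "s * pmf p i \<le> (1 - s) * pmf q i" "r * pmf q i \<le> (1 - r) * pmf p i"
      by (auto simp: algebra_simps)
  qed
  have l: "lo \<le> l i \<and> l i \<le> hi" for i
  proof (cases "d i \<noteq> 0 \<or> ?m i = 0 \<or> u i \<noteq> 0")
    case True
    then show ?thesis using \<open>lo \<le> 0\<close> \<open>0 \<le> hi\<close> by (auto simp: l_def)
  next
    case False
    then have m: "0 < pmf p i" "0 < pmf q i" "s * pmf p i \<le> (1 - s) * pmf q i" "r * pmf q i \<le> (1 - r) * pmf p i"
      using mid[of i] by auto
    have "s / (1 - s) \<le> pmf q i / pmf p i" "pmf q i / pmf p i \<le> (1 - r) / r"
      using m s r by (auto simp: divide_simps mult_ac)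
    moreover have "0 < s / (1 - s)" using s by simp
    moreover have "0 < pmf q i / pmf p i" using m by simp
    ultimately show ?thesis using False by (auto simp: l_def lo_def hi_def ln_mono)
  qed
  have ratio: "pmf q' i = pmf p' i * exp (l i)" if "i < k" for i
  proof (cases "pmf q i < s * ?m i")
    case True
    then have "d i \<noteq> 0" by (simp add: d_def)
    have "s * ?m i = (?m i - s * ?m i) * (s / (1 - s))" using s by (simp add: field_simps)
    then show ?thesis using True \<open>d i \<noteq> 0\<close> that by (simp add: p' q' P_def Q_def l_def exps)
  next
    case F: False
    then have d: "d i = 0" by (simp add: d_def)
    show ?thesis
    proof (cases "pmf p i < r * ?m i")
      case True
      then have "u i \<noteq> 0" by (simp add: u_def)
      moreover have "?m i \<noteq> 0" using True by (metis mult_zero_right pmf_nonneg not_less)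
      moreover have "?m i - r * ?m i = r * ?m i * ((1 - r) / r)" using r by (simp add: field_simps)
      ultimately show ?thesis using True F d that by (simp add: p' q' P_def Q_def l_def exps)
    next
      case False
      then have u: "u i = 0" by (simp add: u_def)
      show ?thesis
      proof (cases "?m i = 0")
        case True
        then have "pmf p i = 0" "pmf q i = 0" using pmf_nonneg[of p i] pmf_nonneg[of q i] by - (linarith+)
        then show ?thesis using that by (simp add: p' q' P_def Q_def)
      next
        case m: False
        then show ?thesis using mid[OF d u m] F False d u that by (simp add: p' q' P_def Q_def l_def)
      qed
    qed
  qed
  have main: "n_B_rob {..<k} p q \<pi> \<delta> \<epsilon> = n_B {..<k} p' q' \<pi> \<delta> \<and> n_B {..<k} p' q' \<pi> \<delta> \<noteq> \<infinity>"
    if "0 < \<pi>" "\<pi> < 1" "0 < \<delta>" for \<pi> \<delta>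
  proof -
    have *: "pmf p' x = pmf p x + u x - d x" "pmf q' x = pmf q x + d x - u x" if "x \<in> {..<k}" for x
      using that p'(2) q'(2) PQ by auto
    have ud: "0 \<le> u x" "0 \<le> d x" "d x \<noteq> 0 \<Longrightarrow> l x = lo" for x by (auto simp: u_def d_def l_def)
    have uhi: "l x = hi" if "u x \<noteq> 0" for x
    proof -
      have "pmf p x < r * ?m x" using that by (auto simp: u_def max_def split: if_splits)
      moreover then have "?m x \<noteq> 0" by (metis mult_zero_right pmf_nonneg not_less)
      moreover have "d x = 0" using excl[of x] calculation(1) by (force simp: d_def)
      ultimately show ?thesis using that by (simp add: l_def)
    qed
    have su: "sum u {..<k} = \<epsilon>" "sum d {..<k} = \<epsilon>" using s r by (auto simp: u_def d_def)
    show ?thesis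
      using n_B_rob_eq_n_B[OF finite_lessThan supp p'(1) q'(1) \<open>p \<noteq> q\<close> \<open>p' \<noteq> q'\<close> \<open>0 < \<epsilon>\<close> *
          ud(1) uhi su(1) ud(2,3) su(2) l ratio that] by simp
  qed
  show thesis by (rule that[OF p'(1) q'(1) p'(2)[unfolded P_def, folded out_p_def] q'(2)[unfolded Q_def, folded out_q_def] main])
qed

section \<open>The program and its running time\<close>

text \<open>A weakest precondition for total correctness, with the cost as an argument of the
  postcondition; its equations evaluate loop-free code by simplification.\<close>

definition run :: "(real \<Rightarrow> nat) \<Rightarrow> com \<Rightarrow> state \<Rightarrow> (nat \<Rightarrow> state \<Rightarrow> bool) \<Rightarrow> bool" where
  "run w c s Q \<longleftrightarrow> (\<exists>t s'. exec w c s t s' \<and> Q t s')"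

inductive_cases exec_elims:
  "exec w Skip s t s'" "exec w (IAssign x e) s t s'" "exec w (RAssign x i f) s t s'"
  "exec w (Seq c1 c2) s t s'" "exec w (Cond b c1 c2) s t s'"

lemma runI: "exec w c s t s' \<Longrightarrow> Q t s' \<Longrightarrow> run w c s Q"
  unfolding run_def by blast

lemma runE:
  assumes "run w c s Q"
  obtains t s' where "exec w c s t s'" "Q t s'"
  using assms unfolding run_def by blast

lemma run_Skip: "run w Skip s Q \<longleftrightarrow> Q 1 s"
proof
  assume "Q 1 s"
  with exec.Skip show "run w Skip s Q" by (rule runI)
qed (auto elim!: runE exec_elims)

lemma run_IAssign:
  "run w (IAssign x e) s Q \<longleftrightarrow> Q (icost w e s + 1) ((fst s)(x := ival e s), snd s)"
proof
  assume "Q (icost w e s + 1) ((fst s)(x := ival e s), snd s)"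
  with exec.IAssign show "run w (IAssign x e) s Q" by (rule runI)
qed (auto elim!: runE exec_elims)

lemma run_RAssign:
  "run w (RAssign x i f) s Q \<longleftrightarrow> Q (icost w i s + rcost w f s + 1)
     (fst s, (snd s)(x := (snd s x)(ival i s := rval f s)))"
proof
  assume "Q (icost w i s + rcost w f s + 1) (fst s, (snd s)(x := (snd s x)(ival i s := rval f s)))"
  with exec.RAssign show "run w (RAssign x i f) s Q" by (rule runI)
qed (auto elim!: runE exec_elims)

lemma run_Seq:
  "run w (Seq c1 c2) s Q \<longleftrightarrow> run w c1 s (\<lambda>t1 s1. run w c2 s1 (\<lambda>t2. Q (t1 + t2)))"
proof
  assume "run w (Seq c1 c2) s Q"
  then obtain t s' where "exec w (Seq c1 c2) s t s'" "Q t s'" by (rule runE)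
  then show "run w c1 s (\<lambda>t1 s1. run w c2 s1 (\<lambda>t2. Q (t1 + t2)))"
    by (elim exec_elims) (intro runI, assumption+, simp)
next
  assume "run w c1 s (\<lambda>t1 s1. run w c2 s1 (\<lambda>t2. Q (t1 + t2)))"
  then obtain t1 s1 t2 s2 where "exec w c1 s t1 s1" "exec w c2 s1 t2 s2" "Q (t1 + t2) s2"
    by (elim runE)
  then show "run w (Seq c1 c2) s Q" by (rule runI[OF exec.Seq])
qed

lemma run_Cond:
  "run w (Cond b c1 c2) s Q \<longleftrightarrow> run w (if bval b s then c1 else c2) s (\<lambda>t. Q (bcost w b s + t))"
proof
  assume "run w (Cond b c1 c2) s Q"
  then obtain t s' where "exec w (Cond b c1 c2) s t s'" "Q t s'" by (rule runE)
  then show "run w (if bval b s then c1 else c2) s (\<lambda>t. Q (bcost w b s + t))"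
    by (elim exec_elims) (rule runI, simp, simp)+
next
  assume "run w (if bval b s then c1 else c2) s (\<lambda>t. Q (bcost w b s + t))"
  then obtain t s' where "exec w (if bval b s then c1 else c2) s t s'" "Q (bcost w b s + t) s'"
    by (rule runE)
  then show "run w (Cond b c1 c2) s Q"
    by (cases "bval b s") (auto intro: runI exec.CondTrue exec.CondFalse)
qed

lemmas run_simps = run_Skip run_IAssign run_RAssign run_Seq run_Cond

lemma run_mono: "run w c s Q \<Longrightarrow> (\<And>t s'. Q t s' \<Longrightarrow> R t s') \<Longrightarrow> run w c s R"
  unfolding run_def by blast

text \<open>A loop test costs two index reads and a comparison, at most \<open>3 * b\<close>; the
  final \<open>3 * b\<close> pays for the failing test. The start value \<open>n\<close> is left
  general for the induction on \<open>k - n\<close>.\<close>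

lemma run_For:
  assumes inv: "\<And>n s. I n s \<Longrightarrow> fst s x = n \<and> fst s ''k'' = k"
    and body: "\<And>n s. n < k \<Longrightarrow> I n s \<Longrightarrow> run w c s (\<lambda>t s'. t \<le> T \<and> I (Suc n) s')"
    and cost: "\<And>n. n \<le> k \<Longrightarrow> w (real n) \<le> b" "1 \<le> b"
    and "n \<le> k" "I n s"
  shows "run w (While (ILess (IVar x) (IVar ''k'')) c) s
    (\<lambda>t s'. t \<le> (k - n) * (3 * b + T) + 3 * b \<and> I k s')"
  using assms(5,6)
proof (induction "k - n" arbitrary: n s)
  case 0
  then have "n = k" by simp
  then have "\<not> bval (ILess (IVar x) (IVar ''k'')) s" using inv[OF 0(3)] by simp
  moreover have "bcost w (ILess (IVar x) (IVar ''k'')) s \<le> 3 * b"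
    using inv[OF 0(3)] \<open>n = k\<close> cost(1)[of k] cost(2) by simp
  ultimately show ?case
    using 0(3) \<open>n = k\<close> by (intro runI[OF exec.WhileFalse]) simp_all
next
  case (Suc m)
  let ?b = "ILess (IVar x) (IVar ''k'')"
  have "n < k" using Suc(2) by simp
  then have b: "bval ?b s" using inv[OF Suc(4)] by simp
  have bc: "bcost w ?b s \<le> 3 * b"
    using inv[OF Suc(4)] \<open>n < k\<close> cost(1)[of k] cost(1)[of n] cost(2) by simp
  obtain t1 s1 where 1: "exec w c s t1 s1" "t1 \<le> T" "I (Suc n) s1"
    using body[OF \<open>n < k\<close> Suc(4)] unfolding run_def by blast
  obtain t2 s2 where 2: "exec w (While ?b c) s1 t2 s2" "t2 \<le> (k - Suc n) * (3 * b + T) + 3 * b" "I k s2"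
  proof (rule runE)
    show "run w (While ?b c) s1 (\<lambda>t s'. t \<le> (k - Suc n) * (3 * b + T) + 3 * b \<and> I k s')"
      by (rule Suc(1)) (use Suc(2) \<open>n < k\<close> 1(3) in simp_all)
  qed blast
  have "k - n = Suc (k - Suc n)" using \<open>n < k\<close> by simp
  then have "(k - n) * (3 * b + T) + 3 * b = (k - Suc n) * (3 * b + T) + 3 * b + (3 * b + T)"
    by simp
  then have "bcost w ?b s + t1 + t2 \<le> (k - n) * (3 * b + T) + 3 * b"
    using bc 1(2) 2(2) by linarith
  then show ?case
    using 2(3) by (intro runI[OF exec.WhileTrue[OF b 1(1) 2(1)]]) simp
qed

section \<open>Program and cost of the clipping levels\<close>

definition incr :: "vname \<Rightarrow> com" where
  "incr x = IAssign x (IPlus (IVar x) (INum 1))"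

definition accumulate :: "vname \<Rightarrow> vname \<Rightarrow> com" where
  "accumulate a b =
     Cond (BNot (RLess (RTimes (RArr a (IVar ''j'')) (RArr b (IVar ''i'')))
                       (RTimes (RArr a (IVar ''i'')) (RArr b (IVar ''j'')))))
       (Seq (RAssign ''num'' (INum 0) (RPlus (RArr ''num'' (INum 0)) (RArr a (IVar ''i''))))
            (RAssign ''den'' (INum 0) (RPlus (RArr ''den'' (INum 0))
               (RPlus (RArr a (IVar ''i'')) (RArr b (IVar ''i''))))))
       Skip"

definition accumulate_loop :: "vname \<Rightarrow> vname \<Rightarrow> com" where
  "accumulate_loop a b = While (ILess (IVar ''i'') (IVar ''k'')) (Seq (accumulate a b) (incr ''i''))"

text \<open>\<open>num\<close> starts at \<open>eps\<close> instead of 0, so the inner loop leaves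
  the complete numerator of the level in it.\<close>

definition level_step :: "vname \<Rightarrow> vname \<Rightarrow> vname \<Rightarrow> com" where
  "level_step a b out =
     Seq (RAssign ''num'' (INum 0) (RArr ''eps'' (INum 0)))
    (Seq (RAssign ''den'' (INum 0) (RNum 0))
    (Seq (IAssign ''i'' (INum 0))
    (Seq (accumulate_loop a b)
    (Seq (Cond (RLess (RDiv (RArr ''num'' (INum 0)) (RArr ''den'' (INum 0))) (RArr out (INum 0)))
           (RAssign out (INum 0) (RDiv (RArr ''num'' (INum 0)) (RArr ''den'' (INum 0)))) Skip)
         (incr ''j'')))))"

definition level_loop :: "vname \<Rightarrow> vname \<Rightarrow> vname \<Rightarrow> com" where
  "level_loop a b out = While (ILess (IVar ''j'') (IVar ''k'')) (level_step a b out)"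

definition min_level_com :: "vname \<Rightarrow> vname \<Rightarrow> vname \<Rightarrow> com" where
  "min_level_com a b out =
     Seq (RAssign out (INum 0) (RNum 1)) (Seq (IAssign ''j'' (INum 0)) (level_loop a b out))"

lemma sel_sum_0: "sel_sum A B j f 0 = 0"
  by (simp add: sel_sum_def)

lemma sel_sum_Suc: "sel_sum A B j f (Suc n) = sel_sum A B j f n + (if A j * B n < A n * B j then 0 else f n)"
  by (simp add: sel_sum_def)

text \<open>One bound \<open>c\<close> on the weights of all values arising in a level computation;
  unit weights take \<open>c = 1\<close>, bit sizes a linear \<open>c\<close>. The range up to
  \<open>Suc k\<close> includes the constant 1 even for \<open>k = 0\<close>.\<close>

locale min_level_cost =
  fixes w :: "real \<Rightarrow> nat" and c k :: nat and A B :: "nat \<Rightarrow> real" and e :: real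
  assumes c_pos: "1 \<le> c"
    and w_nat: "\<And>n. n \<le> Suc k \<Longrightarrow> w (real n) \<le> c"
    and w_A: "\<And>i. i < k \<Longrightarrow> w (A i) \<le> c"
    and w_B: "\<And>i. i < k \<Longrightarrow> w (B i) \<le> c"
    and w_sum: "\<And>i. i < k \<Longrightarrow> w (A i + B i) \<le> c"
    and w_prod: "\<And>i j. i < k \<Longrightarrow> j < k \<Longrightarrow> w (A i * B j) \<le> c"
    and w_e: "w e \<le> c"
    and w_num: "\<And>j n. j < k \<Longrightarrow> n \<le> k \<Longrightarrow> w (e + sel_sum A B j A n) \<le> c"
    and w_den: "\<And>j n. j < k \<Longrightarrow> n \<le> k \<Longrightarrow> w (sel_sum A B j (\<lambda>i. A i + B i) n) \<le> c"
    and w_level: "\<And>j. j < k \<Longrightarrow> w (level A B e k j) \<le> c"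
begin

lemma w_min_level: "j \<le> k \<Longrightarrow> w (min_level A B e k j) \<le> c"
  using min_level_cases[of A B e k j] w_nat[of 1] w_level by auto

lemma run_accumulate_loop:
  assumes ab: "a \<notin> {''num'', ''den'', out}" "b \<notin> {''num'', ''den'', out}" "out \<notin> {''num'', ''den''}"
    and M: "M a = A" "M b = B" and "j < k"
    and init: "fst s ''k'' = k" "fst s ''j'' = j" "fst s ''i'' = 0"
      "snd s ''num'' 0 = e" "snd s ''den'' 0 = 0" "snd s out 0 = v"
      "\<forall>x. x \<notin> {''num'', ''den'', out} \<longrightarrow> snd s x = M x"
  shows "run w (accumulate_loop a b) s (\<lambda>t s'. t \<le> k * (3 * c + 40 * c) + 3 * c
    \<and> fst s' ''k'' = k \<and> fst s' ''j'' = j \<and> snd s' ''num'' 0 = e + sel_sum A B j A k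
    \<and> snd s' ''den'' 0 = sel_sum A B j (\<lambda>i. A i + B i) k \<and> snd s' out 0 = v
    \<and> (\<forall>x. x \<notin> {''num'', ''den'', out} \<longrightarrow> snd s' x = M x))"
proof -
  define I where "I n s \<longleftrightarrow> fst s ''i'' = n \<and> fst s ''k'' = k \<and> fst s ''j'' = j
    \<and> snd s ''num'' 0 = e + sel_sum A B j A n
    \<and> snd s ''den'' 0 = sel_sum A B j (\<lambda>i. A i + B i) n \<and> snd s out 0 = v
    \<and> (\<forall>x. x \<notin> {''num'', ''den'', out} \<longrightarrow> snd s x = M x)" for n s
  \<comment> \<open>The longer branch adds up 33 terms, each at most \<open>c\<close>; 40 leaves
    slack.\<close>
  have step: "run w (Seq (accumulate a b) (incr ''i'')) s (\<lambda>t s'. t \<le> 40 * c \<and> I (Suc n) s')"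
    if "n < k" "I n s" for n s
  proof -
    have s: "fst s ''i'' = n" "fst s ''k'' = k" "fst s ''j'' = j"
      "snd s ''num'' 0 = e + sel_sum A B j A n"
      "snd s ''den'' 0 = sel_sum A B j (\<lambda>i. A i + B i) n" "snd s out 0 = v"
      "snd s a = A" "snd s b = B" "\<And>x. x \<noteq> ''num'' \<Longrightarrow> x \<noteq> ''den'' \<Longrightarrow> x \<noteq> out \<Longrightarrow> snd s x = M x"
      using that(2) ab M by (auto simp: I_def)
    show ?thesis
      using ab s \<open>n < k\<close> \<open>j < k\<close> c_pos w_nat[of 0] w_nat[of 1] w_nat[of j] w_nat[of n] w_nat[of "Suc n"]
        w_A[of j] w_A[of n] w_B[of j] w_B[of n] w_sum[of n] w_prod[of j n] w_prod[of n j]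
        w_num[of j n] w_num[of j "Suc n"] w_den[of j n] w_den[of j "Suc n"]
      by (cases "A j * B n < A n * B j")
        (simp_all add: accumulate_def incr_def run_simps I_def sel_sum_Suc add.assoc)
  qed
  have "I 0 s" using init by (simp add: I_def sel_sum_0)
  have "run w (accumulate_loop a b) s (\<lambda>t s'. t \<le> (k - 0) * (3 * c + 40 * c) + 3 * c \<and> I k s')"
    unfolding accumulate_loop_def
    using c_pos w_nat step \<open>I 0 s\<close>
    by (intro run_For[where I = I]) (simp_all add: I_def)
  then show ?thesis
    by (rule run_mono) (simp add: I_def)
qed

text \<open>The array names are parameters because the code runs twice with \<open>p\<close> and
  \<open>q\<close> exchanged. The frame \<open>M\<close> keeps the inputs, and in the second pass
  also the level \<open>s\<close>.\<close>

lemma run_min_level_com: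
  assumes ab: "a \<notin> {''num'', ''den'', out}" "b \<notin> {''num'', ''den'', out}" "out \<notin> {''num'', ''den'', ''eps''}"
    and M: "M a = A" "M b = B" "M ''eps'' 0 = e"
    and init: "fst s ''k'' = k" "\<forall>x. x \<notin> {''num'', ''den'', out} \<longrightarrow> snd s x = M x"
  shows "run w (min_level_com a b out) s (\<lambda>t s'. t \<le> 100 * c * (k + 1)\<^sup>2
    \<and> fst s' ''k'' = k \<and> snd s' out 0 = min_level A B e k k
    \<and> (\<forall>x. x \<notin> {''num'', ''den'', out} \<longrightarrow> snd s' x = M x))"
proof -
  let ?T = "k * (3 * c + 40 * c) + 40 * c"
  define I where "I j s \<longleftrightarrow> fst s ''k'' = k \<and> fst s ''j'' = j \<and> snd s out 0 = min_level A B e k j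
    \<and> (\<forall>x. x \<notin> {''num'', ''den'', out} \<longrightarrow> snd s x = M x)" for j s
  have step: "run w (level_step a b out) s (\<lambda>t s'. t \<le> ?T \<and> I (Suc j) s')" if "j < k" "I j s" for j s
  proof -
    have s: "fst s ''k'' = k" "fst s ''j'' = j" "snd s out 0 = min_level A B e k j"
      and frame: "\<And>x. x \<noteq> ''num'' \<Longrightarrow> x \<noteq> ''den'' \<Longrightarrow> x \<noteq> out \<Longrightarrow> snd s x = M x"
      using that(2) by (simp_all add: I_def)
    have eps: "snd s ''eps'' 0 = e" using frame[of "''eps''"] ab(3) M(3) by auto
    let ?s = "((fst s)(''i'' := 0), (snd s)(''num'' := (snd s ''num'')(0 := e), ''den'' := (snd s ''den'')(0 := 0)))"
    have loop: "run w (accumulate_loop a b) ?s (\<lambda>t s'. t \<le> k * (3 * c + 40 * c) + 3 * c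
      \<and> fst s' ''k'' = k \<and> fst s' ''j'' = j \<and> snd s' ''num'' 0 = e + sel_sum A B j A k
      \<and> snd s' ''den'' 0 = sel_sum A B j (\<lambda>i. A i + B i) k \<and> snd s' out 0 = min_level A B e k j
      \<and> (\<forall>x. x \<notin> {''num'', ''den'', out} \<longrightarrow> snd s' x = M x))"
      by (rule run_accumulate_loop) (use ab s frame M \<open>j < k\<close> in simp_all)
    have lev: "(e + sel_sum A B j A k) / sel_sum A B j (\<lambda>i. A i + B i) k = level A B e k j"
      by (simp add: level_def)
    show ?thesis
      unfolding level_step_def
      apply (simp add: run_simps s eps)
      apply (rule run_mono[OF loop])
      using ab \<open>j < k\<close> c_pos w_nat[of 0] w_nat[of 1] w_nat[of j] w_nat[of "Suc j"]
        w_num[of j k] w_den[of j k] w_e w_level[of j] w_min_level[of j] w_min_level[of "Suc j"]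
      by (simp add: incr_def run_simps I_def lev)
  qed
  let ?s = "((fst s)(''j'' := 0), (snd s)(out := (snd s out)(0 := 1)))"
  have "I 0 ?s" using init ab(3) by (simp add: I_def)
  then have loop: "run w (level_loop a b out) ?s (\<lambda>t s'. t \<le> (k - 0) * (3 * c + ?T) + 3 * c \<and> I k s')"
    unfolding level_loop_def using c_pos w_nat step
    by (intro run_For[where I = I]) (simp_all add: I_def)
  have cost: "t0 + t \<le> 100 * c * (k + 1)\<^sup>2" if "t \<le> (k - 0) * (3 * c + ?T) + 3 * c" "t0 \<le> 10 * c" for t0 t
  proof -
    have "t0 + t \<le> 43 * (c * k\<^sup>2) + 43 * (c * k) + 13 * c"
      using that by (simp add: algebra_simps power2_eq_square)
    also have "\<dots> \<le> 100 * (c * k\<^sup>2) + 200 * (c * k) + 100 * c" by simp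
    also have "\<dots> = 100 * c * (k + 1)\<^sup>2" by (simp add: algebra_simps power2_eq_square)
    finally show ?thesis .
  qed
  show ?thesis
    unfolding min_level_com_def
    apply (simp add: run_simps del: power2_sum)
    apply (rule run_mono[OF loop])
    subgoal for t s'
      using c_pos w_nat[of 0] w_nat[of 1] cost[of t "w 0 + w 1 + 1 + (w 0 + 1)"]
      by (simp add: I_def)
    done
qed

end

section \<open>Writing the clipped pair\<close>

definition output_step :: com where
  "output_step =
    (let m = RPlus (RArr ''p'' (IVar ''i'')) (RArr ''q'' (IVar ''i''));
         lo = RTimes (RArr ''s'' (INum 0)) m; hi = RTimes (RArr ''r'' (INum 0)) m
     in Seq
      (Cond (RLess (RArr ''q'' (IVar ''i'')) lo)
        (Seq (RAssign ''p_out'' (IVar ''i'') (RMinus m lo)) (RAssign ''q_out'' (IVar ''i'') lo))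
        (Cond (RLess (RArr ''p'' (IVar ''i'')) hi)
          (Seq (RAssign ''p_out'' (IVar ''i'') hi) (RAssign ''q_out'' (IVar ''i'') (RMinus m hi)))
          (Seq (RAssign ''p_out'' (IVar ''i'') (RArr ''p'' (IVar ''i'')))
               (RAssign ''q_out'' (IVar ''i'') (RArr ''q'' (IVar ''i''))))))
      (incr ''i''))"

definition least_favourable_com :: com where
  "least_favourable_com =
     Seq (min_level_com ''q'' ''p'' ''s'')
    (Seq (min_level_com ''p'' ''q'' ''r'')
    (Seq (IAssign ''i'' (INum 0))
         (While (ILess (IVar ''i'') (IVar ''k'')) output_step)))"

lemma run_output_loop:
  assumes init: "fst st ''k'' = k" "fst st ''i'' = 0" "snd st ''p'' = A" "snd st ''q'' = B"
      "snd st ''s'' 0 = s" "snd st ''r'' 0 = r"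
    and c: "1 \<le> c" "\<And>n. n \<le> Suc k \<Longrightarrow> w (real n) \<le> c" "w s \<le> c" "w r \<le> c"
      "\<And>i. i < k \<Longrightarrow> w (A i) \<le> c" "\<And>i. i < k \<Longrightarrow> w (B i) \<le> c" "\<And>i. i < k \<Longrightarrow> w (A i + B i) \<le> c"
      "\<And>i. i < k \<Longrightarrow> w (s * (A i + B i)) \<le> c" "\<And>i. i < k \<Longrightarrow> w (r * (A i + B i)) \<le> c"
      "\<And>i. i < k \<Longrightarrow> w (A i + B i - s * (A i + B i)) \<le> c"
      "\<And>i. i < k \<Longrightarrow> w (A i + B i - r * (A i + B i)) \<le> c"
  shows "run w (While (ILess (IVar ''i'') (IVar ''k'')) output_step) st (\<lambda>t st'.
    t \<le> k * (3 * c + 80 * c) + 3 * c \<and>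
    (\<forall>i<k. snd st' ''p_out'' i = out_p s r (A i) (B i) \<and> snd st' ''q_out'' i = out_q s r (A i) (B i)))"
proof -
  define I where "I n st \<longleftrightarrow> fst st ''i'' = n \<and> fst st ''k'' = k \<and> snd st ''p'' = A \<and> snd st ''q'' = B
    \<and> snd st ''s'' 0 = s \<and> snd st ''r'' 0 = r
    \<and> (\<forall>i<n. snd st ''p_out'' i = out_p s r (A i) (B i) \<and> snd st ''q_out'' i = out_q s r (A i) (B i))" for n st
  \<comment> \<open>The most expensive branch, with both comparisons, adds up 52 terms, each at most
    \<open>c\<close>; 80 leaves slack.\<close>
  have step: "run w output_step st (\<lambda>t st'. t \<le> 80 * c \<and> I (Suc n) st')" if "n < k" "I n st" for n st
  proof -
    have st: "fst st ''i'' = n" "fst st ''k'' = k" "snd st ''p'' = A" "snd st ''q'' = B"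
      "snd st ''s'' 0 = s" "snd st ''r'' 0 = r"
      and out: "\<And>i. i < n \<Longrightarrow> snd st ''p_out'' i = out_p s r (A i) (B i)"
        "\<And>i. i < n \<Longrightarrow> snd st ''q_out'' i = out_q s r (A i) (B i)"
      using that(2) by (simp_all add: I_def)
    note w = c(2)[of 0] c(2)[of 1] c(2)[of n] c(2)[of "Suc n"] c(5-11)[OF \<open>n < k\<close>]
    consider "B n < s * (A n + B n)" | "\<not> B n < s * (A n + B n)" "A n < r * (A n + B n)"
      | "\<not> B n < s * (A n + B n)" "\<not> A n < r * (A n + B n)" by blast
    then show ?thesis
    proof cases
      case 1
      then have "out_p s r (A n) (B n) = A n + B n - s * (A n + B n)" "out_q s r (A n) (B n) = s * (A n + B n)"
        by (simp_all only: out_p_def out_q_def if_True)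
      then show ?thesis using 1 w \<open>n < k\<close> c(1,3,4) st out
        by (simp add: output_step_def Let_def incr_def run_simps I_def less_Suc_eq)
    next
      case 2
      then have "out_p s r (A n) (B n) = r * (A n + B n)" "out_q s r (A n) (B n) = A n + B n - r * (A n + B n)"
        by (simp_all only: out_p_def out_q_def if_True if_False)
      then show ?thesis using 2 w \<open>n < k\<close> c(1,3,4) st out
        by (simp add: output_step_def Let_def incr_def run_simps I_def less_Suc_eq)
    next
      case 3
      then have "out_p s r (A n) (B n) = A n" "out_q s r (A n) (B n) = B n"
        by (simp_all only: out_p_def out_q_def if_False)
      then show ?thesis using 3 w \<open>n < k\<close> c(1,3,4) st out
        by (simp add: output_step_def Let_def incr_def run_simps I_def less_Suc_eq)
    qed
  qed
  have "I 0 st" using init by (simp add: I_def)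
  then have "run w (While (ILess (IVar ''i'') (IVar ''k'')) output_step) st
      (\<lambda>t st'. t \<le> (k - 0) * (3 * c + 80 * c) + 3 * c \<and> I k st')"
    using c(1,2) step by (intro run_For[where I = I]) (simp_all add: I_def)
  then show ?thesis by (rule run_mono) (simp add: I_def)
qed

lemma run_least_favourable_com:
  assumes ps: "min_level_cost w c k B A e" and pr: "min_level_cost w c k A B e"
    and input: "fst st ''k'' = k" "snd st ''p'' = A" "snd st ''q'' = B" "snd st ''eps'' 0 = e"
    and s: "s = min_level B A e k k" and r: "r = min_level A B e k k"
    and c: "\<And>i. i < k \<Longrightarrow> w (s * (A i + B i)) \<le> c" "\<And>i. i < k \<Longrightarrow> w (r * (A i + B i)) \<le> c"
      "\<And>i. i < k \<Longrightarrow> w (A i + B i - s * (A i + B i)) \<le> c"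
      "\<And>i. i < k \<Longrightarrow> w (A i + B i - r * (A i + B i)) \<le> c"
  shows "run w least_favourable_com st (\<lambda>t st'. t \<le> 400 * c * (k + 1)\<^sup>2 \<and>
    (\<forall>i<k. snd st' ''p_out'' i = out_p s r (A i) (B i) \<and> snd st' ''q_out'' i = out_q s r (A i) (B i)))"
proof -
  interpret s: min_level_cost w c k B A e by (rule ps)
  interpret r: min_level_cost w c k A B e by (rule pr)
  have ws: "w s \<le> c" "w r \<le> c"
    using s.w_min_level[of k] r.w_min_level[of k] by (simp_all add: s r)
  have "run w (min_level_com ''q'' ''p'' ''s'') st (\<lambda>t s'. t \<le> 100 * c * (k + 1)\<^sup>2
    \<and> fst s' ''k'' = k \<and> snd s' ''s'' 0 = min_level B A e k k
    \<and> (\<forall>x. x \<notin> {''num'', ''den'', ''s''} \<longrightarrow> snd s' x = snd st x))"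
    by (rule s.run_min_level_com) (use input in auto)
  then obtain t1 st1 where 1: "exec w (min_level_com ''q'' ''p'' ''s'') st t1 st1" "t1 \<le> 100 * c * (k + 1)\<^sup>2"
    "fst st1 ''k'' = k" "snd st1 ''s'' 0 = s" "snd st1 ''p'' = A" "snd st1 ''q'' = B" "snd st1 ''eps'' 0 = e"
    by (rule runE) (simp add: s input)
  have "run w (min_level_com ''p'' ''q'' ''r'') st1 (\<lambda>t s'. t \<le> 100 * c * (k + 1)\<^sup>2
    \<and> fst s' ''k'' = k \<and> snd s' ''r'' 0 = min_level A B e k k
    \<and> (\<forall>x. x \<notin> {''num'', ''den'', ''r''} \<longrightarrow> snd s' x = snd st1 x))"
    by (rule r.run_min_level_com) (use 1 in auto)
  then obtain t2 st2 where 2: "exec w (min_level_com ''p'' ''q'' ''r'') st1 t2 st2" "t2 \<le> 100 * c * (k + 1)\<^sup>2"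
    "fst st2 ''k'' = k" "snd st2 ''s'' 0 = s" "snd st2 ''r'' 0 = r" "snd st2 ''p'' = A" "snd st2 ''q'' = B"
    by (rule runE) (simp add: r 1)
  have "run w (While (ILess (IVar ''i'') (IVar ''k'')) output_step) ((fst st2)(''i'' := 0), snd st2) (\<lambda>t st'.
    t \<le> k * (3 * c + 80 * c) + 3 * c \<and>
    (\<forall>i<k. snd st' ''p_out'' i = out_p s r (A i) (B i) \<and> snd st' ''q_out'' i = out_q s r (A i) (B i)))"
    using 2 ws c s.c_pos s.w_nat r.w_A r.w_B r.w_sum by (intro run_output_loop) simp_all
  then obtain t3 st3 where 3: "exec w (While (ILess (IVar ''i'') (IVar ''k'')) output_step) ((fst st2)(''i'' := 0), snd st2) t3 st3"
    "t3 \<le> k * (3 * c + 80 * c) + 3 * c"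
    "\<forall>i<k. snd st3 ''p_out'' i = out_p s r (A i) (B i) \<and> snd st3 ''q_out'' i = out_q s r (A i) (B i)"
    by (rule runE) simp
  have init: "exec w (IAssign ''i'' (INum 0)) st2 (w 0 + 1) ((fst st2)(''i'' := 0), snd st2)"
    using exec.IAssign[of w "''i''" "INum 0" st2] by simp
  have "t1 + (t2 + (w 0 + 1 + t3)) \<le> 400 * c * (k + 1)\<^sup>2"
  proof -
    have "t1 + (t2 + (w 0 + 1 + t3)) \<le> 200 * c * (k + 1)\<^sup>2 + 83 * (c * k) + 5 * c"
      using 1(2) 2(2) 3(2) s.w_nat[of 0] s.c_pos by (simp add: mult.commute[of k])
    moreover have "83 * (c * k) + 5 * c \<le> 200 * (c * k\<^sup>2 + 2 * (c * k) + c)" by simp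
    moreover have "200 * (c * k\<^sup>2 + 2 * (c * k) + c) = 200 * c * (k + 1)\<^sup>2"
      by (simp add: algebra_simps power2_eq_square)
    ultimately show ?thesis by linarith
  qed
  with 3(3) show ?thesis
    unfolding least_favourable_com_def
    by (intro runI[OF exec.Seq[OF 1(1) exec.Seq[OF 2(1) exec.Seq[OF init 3(1)]]]]) simp
qed

section \<open>Bit sizes\<close>

text \<open>Passing to lowest terms only shrinks numerator and denominator, so sizes can be
  estimated from any representation \<open>n / d\<close>.\<close>

lemma bit_size_le:
  fixes x :: real and n d :: int
  assumes "x * of_int d = of_int n" "0 < d" "\<bar>n\<bar> < 2 ^ a" "d < 2 ^ a"
  shows "bit_size x \<le> 2 * a"
proof -
  obtain u v where uv: "quotient_of (Fract n d) = (u, v)" by fastforce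
  have "x = of_rat (Fract n d)"
    using assms(1,2) by (simp add: of_rat_rat field_simps)
  then have "(THE r. x = of_rat r) = Fract n d" by (intro the_equality) auto
  then have bs: "bit_size x = floorlog 2 (nat \<bar>u\<bar>) + floorlog 2 (nat v)"
    by (simp add: bit_size_def uv)
  have v: "0 < v" and cop: "coprime u v"
    using quotient_of_denom_pos[OF uv] quotient_of_coprime[OF uv] by auto
  have "Fract u v = Fract n d" using quotient_of_eq[OF uv] .
  then have eq: "u * d = n * v" using v assms(2) by (simp add: eq_rat)
  have "v dvd u * d" unfolding eq by simp
  then have "v dvd d"
    using cop by (simp add: coprime_dvd_mult_right_iff coprime_commute)
  then have "v \<le> d" using assms(2) zdvd_imp_le by blast
  have "\<bar>u\<bar> \<le> \<bar>n\<bar>"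
  proof (cases "n = 0")
    case True
    then show ?thesis using eq assms(2) by simp
  next
    case False
    have "u dvd n * v" unfolding eq[symmetric] by simp
    then have "u dvd n"
      using cop by (simp add: coprime_dvd_mult_left_iff)
    then show ?thesis using False dvd_imp_le_int by blast
  qed
  have nat_bound: "floorlog 2 (nat z) \<le> a" if "0 \<le> z" "z < 2 ^ a" for z :: int
    using that by (intro floorlog_leI) (auto simp: nat_less_iff)
  show ?thesis
    using nat_bound[of "\<bar>u\<bar>"] nat_bound[of v] \<open>v \<le> d\<close> \<open>\<bar>u\<bar> \<le> \<bar>n\<bar>\<close> v assms(3,4) by (simp add: bs)
qed

definition denominator :: "real \<Rightarrow> int" where
  "denominator x = snd (quotient_of (THE r. x = of_rat r))"

lemma denominator:
  assumes "x \<in> \<rat>"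
  shows "0 < denominator x" "denominator x \<le> 2 ^ bit_size x" "x * of_int (denominator x) \<in> \<int>"
proof -
  obtain r where r: "x = of_rat r" using assms by (rule Rats_cases)
  obtain u v where uv: "quotient_of r = (u, v)" by fastforce
  have the: "(THE r. x = of_rat r) = r" using r by (intro the_equality) auto
  have v: "denominator x = v" by (simp add: denominator_def the uv)
  have "0 < v" using quotient_of_denom_pos[OF uv] .
  then show "0 < denominator x" by (simp add: v)
  have "nat v < 2 ^ floorlog 2 (nat v)"
    using floorlog_bounds[of "nat v" 2] \<open>0 < v\<close> by simp
  also have "\<dots> \<le> 2 ^ bit_size x"
    by (intro power_increasing) (auto simp: bit_size_def the uv)
  finally have "int (nat v) < int (2 ^ bit_size x)" by (rule less_imp_of_nat_less)
  then show "denominator x \<le> 2 ^ bit_size x" using \<open>0 < v\<close> by (simp add: v)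
  have "x = of_int u / of_int v"
    using quotient_of_div[OF uv] by (simp add: r of_rat_divide)
  then have "x * of_int v = of_int u" using \<open>0 < v\<close> by simp
  then show "x * of_int (denominator x) \<in> \<int>" by (simp add: v)
qed

lemma Ints_mult_dvd:
  fixes x :: real
  assumes "x * of_int d \<in> \<int>" "d dvd D"
  shows "x * of_int D \<in> \<int>"
proof -
  obtain m where "D = d * m" using assms(2) by (rule dvdE)
  then have "x * of_int D = x * of_int d * of_int m" by simp
  then show ?thesis using assms(1) by (metis Ints_mult Ints_of_int)
qed

text \<open>The product of all denominators serves as \<open>D\<close>: the bit lengths of its
  factors add up in the exponent, and their sum is at most the input size.\<close>

lemma rational_input_common_denominator:
  assumes "rational_input k p q \<epsilon>"
  obtains D :: int where "0 < D" "D \<le> 2 ^ input_size k p q \<epsilon>" "\<epsilon> * of_int D \<in> \<int>"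
    "\<And>i. i < k \<Longrightarrow> pmf p i * of_int D \<in> \<int>" "\<And>i. i < k \<Longrightarrow> pmf q i * of_int D \<in> \<int>"
proof -
  have rat: "\<epsilon> \<in> \<rat>" "\<And>i. i < k \<Longrightarrow> pmf p i \<in> \<rat>" "\<And>i. i < k \<Longrightarrow> pmf q i \<in> \<rat>"
    using assms by (auto simp: rational_input_def)
  let ?d = "\<lambda>i. denominator (pmf p i) * denominator (pmf q i)"
  define D where "D = (\<Prod>i<k. ?d i) * denominator \<epsilon>"
  have dvd: "?d i dvd D" if "i < k" for i
    unfolding D_def using that by (intro dvd_mult2 dvd_prodI) auto
  have "(\<Prod>i<k. ?d i) \<le> (\<Prod>i<k. 2 ^ (bit_size (pmf p i) + bit_size (pmf q i)))"
    using rat denominator unfolding power_add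
    by (intro prod_mono conjI mult_mono) (auto intro: less_imp_le mult_pos_pos)
  also have "\<dots> = 2 ^ (\<Sum>i<k. bit_size (pmf p i) + bit_size (pmf q i))"
    by (simp add: power_sum)
  finally have "D \<le> 2 ^ (\<Sum>i<k. bit_size (pmf p i) + bit_size (pmf q i)) * 2 ^ bit_size \<epsilon>"
    unfolding D_def using denominator[OF rat(1)] by (intro mult_mono) auto
  also have "\<dots> \<le> 2 ^ input_size k p q \<epsilon>"
    unfolding power_add[symmetric] by (intro power_increasing) (auto simp: input_size_def)
  finally have "D \<le> 2 ^ input_size k p q \<epsilon>" .
  moreover have "0 < D"
    unfolding D_def using denominator(1) rat by (intro mult_pos_pos prod_pos) auto
  moreover have "\<epsilon> * of_int D \<in> \<int>"
    by (rule Ints_mult_dvd[OF denominator(3)[OF rat(1)]]) (simp add: D_def)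
  moreover have "pmf p i * of_int D \<in> \<int>" "pmf q i * of_int D \<in> \<int>" if "i < k" for i
    using Ints_mult_dvd[OF denominator(3)[OF rat(2)[OF that]]] Ints_mult_dvd[OF denominator(3)[OF rat(3)[OF that]]]
      dvd_mult_left[OF dvd[OF that]] dvd_mult_right[OF dvd[OF that]] by simp_all
  ultimately show thesis using that by blast
qed

locale common_denominator =
  fixes k N :: nat and A B :: "nat \<Rightarrow> real" and e :: real and D :: int
  assumes nonneg: "\<And>i. i < k \<Longrightarrow> 0 \<le> A i" "\<And>i. i < k \<Longrightarrow> 0 \<le> B i"
    and sums: "sum A {..<k} = 1" "sum B {..<k} = 1" and e: "0 < e" "e \<le> 1"
    and D: "0 < D" "D \<le> 2 ^ N" "e * of_int D \<in> \<int>"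
      "\<And>i. i < k \<Longrightarrow> A i * of_int D \<in> \<int>" "\<And>i. i < k \<Longrightarrow> B i * of_int D \<in> \<int>"
    and kN: "k \<le> N"
begin

text \<open>All numbers in a run are fractions whose denominators divide \<open>D\<^sup>2\<close>, or a quotient of two
  integers of size \<open>O(D)\<close>, possibly multiplied by some \<open>A i + B i\<close>; no sizes accumulate.\<close>

lemma bit_size_bound:
  assumes "x * of_int d = of_int n" "0 < d" "\<bar>n\<bar> \<le> 16 * D\<^sup>2" "d \<le> 16 * D\<^sup>2"
  shows "bit_size x \<le> 4 * N + 12"
proof -
  have "D\<^sup>2 \<le> (2 ^ N)\<^sup>2" using D by (intro power_mono) auto
  also have "\<dots> = 2 ^ (2 * N)" by (simp add: power_even_eq)
  finally have "D\<^sup>2 \<le> 2 ^ (2 * N)" .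
  moreover have "0 < (2 :: int) ^ (2 * N)" by simp
  \<comment> \<open>The 6 extra bits absorb the factor 16 with strict inequality; numerator and
    denominator together then take \<open>2 * (2 * N + 6)\<close> bits.\<close>
  moreover have "(2 :: int) ^ (2 * N + 6) = 64 * 2 ^ (2 * N)" by (simp add: power_add)
  ultimately have "16 * D\<^sup>2 < 2 ^ (2 * N + 6)" by linarith
  then have "bit_size x \<le> 2 * (2 * N + 6)" using assms by (intro bit_size_le[of x d n]) auto
  then show ?thesis by simp
qed

text \<open>For a value of size at most 4, a bound on the denominator also bounds the numerator,
  which is where 16 = 4 * 4 comes from.\<close>

lemma bit_size_bounded:
  assumes "x * of_int d \<in> \<int>" "0 < d" "d \<le> 4 * D\<^sup>2" "\<bar>x\<bar> \<le> 4"
  shows "bit_size x \<le> 4 * N + 12"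
proof -
  obtain n where n: "x * of_int d = of_int n" using assms(1) by (rule Ints_cases)
  have "\<bar>of_int n :: real\<bar> \<le> 4 * of_int d"
    unfolding n[symmetric] abs_mult using assms(2,4) by (intro mult_mono) auto
  then have "\<bar>n\<bar> \<le> 4 * d" by linarith
  then show ?thesis using assms by (intro bit_size_bound[OF n]) auto
qed

lemma D_le_square: "D \<le> D\<^sup>2"
  using D(1) by (simp add: power2_eq_square)

lemma bit_size_bounded_D:
  assumes "x * of_int D \<in> \<int>" "\<bar>x\<bar> \<le> 4"
  shows "bit_size x \<le> 4 * N + 12"
proof (rule bit_size_bounded[OF assms(1) D(1) _ assms(2)])
  show "D \<le> 4 * D\<^sup>2" using D_le_square zero_le_power2[of D] by linarith
qed

lemma weights_le_1:
  assumes "i < k"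
  shows "A i \<le> 1" "B i \<le> 1"
proof -
  have "A i \<le> sum A {..<k}" "B i \<le> sum B {..<k}"
    using assms nonneg by (auto intro!: member_le_sum)
  then show "A i \<le> 1" "B i \<le> 1" by (simp_all add: sums)
qed

lemma sel_sum_bounds:
  assumes "\<And>i. i < k \<Longrightarrow> 0 \<le> f i" "sum f {..<k} \<le> u" "n \<le> k" "\<And>i. i < k \<Longrightarrow> f i * of_int D \<in> \<int>"
  shows "0 \<le> sel_sum A B j f n" "sel_sum A B j f n \<le> u" "sel_sum A B j f n * of_int D \<in> \<int>"
proof -
  show "0 \<le> sel_sum A B j f n"
    unfolding sel_sum_def using assms by (intro sum_nonneg) auto
  have "sel_sum A B j f n \<le> sum f {..<n}"
    unfolding sel_sum_def using assms by (intro sum_mono) auto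
  also have "\<dots> \<le> sum f {..<k}" using assms by (intro sum_mono2) auto
  finally show "sel_sum A B j f n \<le> u" using assms by simp
  show "sel_sum A B j f n * of_int D \<in> \<int>"
    unfolding sel_sum_def sum_distrib_right using assms by (intro Ints_sum) auto
qed

lemma num_bounds:
  assumes "n \<le> k"
  shows "0 < e + sel_sum A B j A n" "e + sel_sum A B j A n \<le> 2" "(e + sel_sum A B j A n) * of_int D \<in> \<int>"
  using sel_sum_bounds[of A 1 n j] nonneg(1) sums(1) D(3,4) e assms by (auto simp: distrib_right)

lemma den_bounds:
  assumes "n \<le> k"
  shows "0 \<le> sel_sum A B j (\<lambda>i. A i + B i) n" "sel_sum A B j (\<lambda>i. A i + B i) n \<le> 2"
    "sel_sum A B j (\<lambda>i. A i + B i) n * of_int D \<in> \<int>"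
  using sel_sum_bounds[of "\<lambda>i. A i + B i" 2 n j] nonneg sums D(4,5) assms
  by (auto simp: distrib_right sum.distrib)

text \<open>Numerator and denominator of a level are integers over \<open>D\<close>, and
  \<open>D\<close> cancels. A level can be large if its selected set has little mass, so the two
  integers are bounded directly and not through the quotient.\<close>

lemma level_fraction:
  assumes "j < k"
  obtains n d where "level A B e k j * of_int d = of_int n" "0 < d" "0 < n" "n \<le> 2 * D" "d \<le> 2 * D"
proof -
  let ?num = "e + sel_sum A B j A k" and ?den = "sel_sum A B j (\<lambda>i. A i + B i) k"
  obtain n where n: "?num * of_int D = of_int n" using num_bounds(3)[of k j] by (auto elim: Ints_cases)
  obtain d where d: "?den * of_int D = of_int d" using den_bounds(3)[of k j] by (auto elim: Ints_cases)
  have pos: "0 < ?den" using sel_sum_pos[of k A B j] nonneg sums assms by blast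
  have D0: "0 < real_of_int D" using D(1) by simp
  have "level A B e k j * of_int d = of_int n"
    using pos by (simp add: level_def flip: n d)
  moreover have "0 < real_of_int d" "0 < real_of_int n"
    unfolding d[symmetric] n[symmetric] using pos num_bounds(1)[of k j] D0 by simp_all
  moreover have "real_of_int d \<le> 2 * real_of_int D" "real_of_int n \<le> 2 * real_of_int D"
    unfolding d[symmetric] n[symmetric] using den_bounds(2)[of k j] num_bounds(2)[of k j] D0
    by (auto intro!: mult_right_mono)
  ultimately show thesis using that[of d n] by linarith
qed

text \<open>Unlike a single level, the minimum is at most 1 thanks to its start value, so control of
  its denominator suffices.\<close>

lemma min_level_fraction:
  assumes "n \<le> k"
  obtains d where "min_level A B e k n * of_int d \<in> \<int>" "0 < d" "d \<le> 2 * D"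
    "0 \<le> min_level A B e k n" "min_level A B e k n \<le> 1"
proof (cases "min_level A B e k n = 1")
  case True
  then show thesis using that[of 1] D(1) by simp
next
  case False
  then obtain j where j: "j < n" "min_level A B e k n = level A B e k j"
    using min_level_cases[of A B e k n] by blast
  obtain m d where *: "level A B e k j * of_int d = of_int m" "0 < d" "0 < m" "m \<le> 2 * D" "d \<le> 2 * D"
  proof -
    have "j < k" using j assms by simp
    then show ?thesis using that level_fraction by blast
  qed
  have "0 < level A B e k j * of_int d" using * by simp
  then have "0 < level A B e k j" using *(2) zero_less_mult_pos2 by (metis of_int_0_less_iff)
  moreover have "min_level A B e k n \<le> 1" by (induction n) auto
  ultimately show thesis using that[of d] * j by simp
qed

lemma min_level_cost_bit_size: "min_level_cost bit_size (4 * N + 12) k A B e"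
proof
  show "bit_size (real n) \<le> 4 * N + 12" if "n \<le> Suc k" for n
  proof -
    have "n < 2 ^ (N + 1)" using that kN less_exp[of "N + 1"] by linarith
    then have "int n < 2 ^ (N + 1)" by (metis of_nat_less_iff of_nat_numeral of_nat_power)
    then have "bit_size (real n) \<le> 2 * (N + 1)"
      by (intro bit_size_le[of _ 1 "int n"]) (simp_all add: one_less_power del: power_Suc)
    then show ?thesis by simp
  qed
  show "bit_size (A i) \<le> 4 * N + 12" "bit_size (B i) \<le> 4 * N + 12"
    "bit_size (A i + B i) \<le> 4 * N + 12" if "i < k" for i
    using that D nonneg[OF that] weights_le_1[OF that]
    by (auto intro!: bit_size_bounded_D simp: distrib_right)
  show "bit_size (A i * B j) \<le> 4 * N + 12" if "i < k" "j < k" for i j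
  proof (rule bit_size_bounded[of _ "D\<^sup>2"])
    have "A i * B j * of_int (D\<^sup>2) = (A i * of_int D) * (B j * of_int D)"
      by (simp add: power2_eq_square)
    then show "A i * B j * of_int (D\<^sup>2) \<in> \<int>" using D(4)[OF that(1)] D(5)[OF that(2)] by (metis Ints_mult)
    have "A i * B j \<le> 1 * 1"
      using nonneg that weights_le_1 by (intro mult_mono) auto
    then show "\<bar>A i * B j\<bar> \<le> 4" using nonneg(1)[OF that(1)] nonneg(2)[OF that(2)] by simp
  qed (use D(1) in auto)
  show "bit_size e \<le> 4 * N + 12" using D e by (intro bit_size_bounded_D) auto
  show "bit_size (e + sel_sum A B j A n) \<le> 4 * N + 12" if "n \<le> k" for j n
    using num_bounds[OF that, of j] by (intro bit_size_bounded_D) auto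
  show "bit_size (sel_sum A B j (\<lambda>i. A i + B i) n) \<le> 4 * N + 12" if "n \<le> k" for j n
    using den_bounds[OF that, of j] by (intro bit_size_bounded_D) auto
  show "bit_size (level A B e k j) \<le> 4 * N + 12" if "j < k" for j
  proof -
    obtain n d where *: "level A B e k j * of_int d = of_int n" "0 < d" "0 < n" "n \<le> 2 * D" "d \<le> 2 * D"
      using level_fraction[OF \<open>j < k\<close>] by blast
    show ?thesis
      using * D(1) D_le_square by (intro bit_size_bound[OF *(1,2)]) auto
  qed
qed simp_all

text \<open>The denominator \<open>d \<le> 2 * D\<close> of the level meets only the denominator
  \<open>D\<close> of the weights, so the product stays quadratic in \<open>D\<close>.\<close>

lemma bit_size_min_level_mult:
  assumes "i < k"
  defines "s \<equiv> min_level A B e k k"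
  shows "bit_size (s * (A i + B i)) \<le> 4 * N + 12" "bit_size (A i + B i - s * (A i + B i)) \<le> 4 * N + 12"
proof -
  obtain d where d: "s * of_int d \<in> \<int>" "0 < d" "d \<le> 2 * D" "0 \<le> s" "s \<le> 1"
    using min_level_fraction[of k] unfolding s_def by blast
  have m: "(A i + B i) * of_int D \<in> \<int>" using D assms by (simp add: distrib_right)
  have b: "0 \<le> A i + B i" "A i + B i \<le> 2"
    using nonneg[OF \<open>i < k\<close>] weights_le_1[OF \<open>i < k\<close>] by auto
  have "s * (A i + B i) * of_int (d * D) = (s * of_int d) * ((A i + B i) * of_int D)" by simp
  then have I1: "s * (A i + B i) * of_int (d * D) \<in> \<int>" using d m by (metis Ints_mult)
  have "(A i + B i) * of_int (d * D) = of_int d * ((A i + B i) * of_int D)" by simp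
  then have "(A i + B i) * of_int (d * D) \<in> \<int>" using m by (metis Ints_mult Ints_of_int)
  then have I2: "(A i + B i - s * (A i + B i)) * of_int (d * D) \<in> \<int>"
    using I1 by (simp only: left_diff_distrib Ints_diff)
  have "d * D \<le> 2 * D * D" using d D by (intro mult_right_mono) auto
  then have dD: "0 < d * D" "d * D \<le> 4 * D\<^sup>2" using d D zero_le_power2[of D] by (auto simp: power2_eq_square)
  have "s * (A i + B i) \<le> 1 * (A i + B i)" "0 \<le> s * (A i + B i)"
    by (rule mult_right_mono[OF d(5) b(1)], rule mult_nonneg_nonneg[OF d(4) b(1)])
  then have "\<bar>s * (A i + B i)\<bar> \<le> 4" "\<bar>A i + B i - s * (A i + B i)\<bar> \<le> 4"
    using b by (simp_all only: abs_le_iff mult_1) linarith+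
  then show "bit_size (s * (A i + B i)) \<le> 4 * N + 12" "bit_size (A i + B i - s * (A i + B i)) \<le> 4 * N + 12"
    using bit_size_bounded[OF I1 dD] bit_size_bounded[OF I2 dD] by blast+
qed

end

section \<open>Equality of the sample complexities\<close>

lemma computes_withinI:
  assumes "run w A (input_state k p q \<epsilon>) (\<lambda>t s. t \<le> b \<and> output_is k s p' q')"
  shows "computes_within w A k p q \<epsilon> b p' q'"
  using assms unfolding run_def computes_within_def by blast

theorem corollary2p8:
  "\<exists>(A :: com) (T :: nat poly) (B :: nat poly) (c :: real) (C :: real). 0 < c \<and> 0 < C \<and>
     (\<forall>(k :: nat) (p :: nat pmf) (q :: nat pmf) (\<epsilon> :: real).
        set_pmf p \<subseteq> {..<k} \<longrightarrow> set_pmf q \<subseteq> {..<k} \<longrightarrow>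
        0 < \<epsilon> \<longrightarrow> \<epsilon> < tv {..<k} p q / 2 \<longrightarrow>
        (\<exists>(p' :: nat pmf) (q' :: nat pmf).
           set_pmf p' \<subseteq> {..<k} \<and> set_pmf q' \<subseteq> {..<k} \<and>
           efficiently_computes A T B k p q \<epsilon> p' q' \<and>
           (\<forall>(\<pi> :: real) (\<delta> :: real).
              0 < \<pi> \<longrightarrow> \<pi> \<le> 1 / 2 \<longrightarrow> 0 < \<delta> \<longrightarrow> \<delta> < \<pi> / 4 \<longrightarrow>
              comparable c C (n_B_rob {..<k} p q \<pi> \<delta> \<epsilon>) (n_B {..<k} p' q' \<pi> \<delta>))))"
proof -
  \<comment> \<open>\<open>T\<close> is the running time bound for \<open>c = 1\<close>;
    \<open>B\<close> multiplies it by \<open>4 * N + 12\<close>, the bound on bit sizes, with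
    \<open>N\<close> the input size.\<close>
  define T :: "nat poly" where "T = smult 400 ([:1, 1:] ^ 2)"
  define B :: "nat poly" where "B = T * [:12, 4:]"
  have T: "poly T n = 400 * (n + 1)\<^sup>2" and B: "poly B n = 400 * (4 * n + 12) * (n + 1)\<^sup>2" for n
    by (simp_all add: T_def B_def algebra_simps)
  have "\<exists>p' q'. set_pmf p' \<subseteq> {..<k} \<and> set_pmf q' \<subseteq> {..<k} \<and>
           efficiently_computes least_favourable_com T B k p q \<epsilon> p' q' \<and>
           (\<forall>(\<pi> :: real) (\<delta> :: real).
              0 < \<pi> \<longrightarrow> \<pi> \<le> 1 / 2 \<longrightarrow> 0 < \<delta> \<longrightarrow> \<delta> < \<pi> / 4 \<longrightarrow>
              comparable 1 1 (n_B_rob {..<k} p q \<pi> \<delta> \<epsilon>) (n_B {..<k} p' q' \<pi> \<delta>))"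
    if supp: "set_pmf p \<subseteq> {..<k}" "set_pmf q \<subseteq> {..<k}" and \<epsilon>: "0 < \<epsilon>" "\<epsilon> < tv {..<k} p q / 2"
    for k and p q :: "nat pmf" and \<epsilon> :: real
  proof -
    define s where "s = min_level (pmf q) (pmf p) \<epsilon> k k"
    define r where "r = min_level (pmf p) (pmf q) \<epsilon> k k"
    obtain p' q' where out: "set_pmf p' \<subseteq> {..<k}" "set_pmf q' \<subseteq> {..<k}"
      "\<And>i. i < k \<Longrightarrow> pmf p' i = out_p s r (pmf p i) (pmf q i)"
      "\<And>i. i < k \<Longrightarrow> pmf q' i = out_q s r (pmf p i) (pmf q i)"
      "\<And>\<pi> \<delta>. 0 < \<pi> \<Longrightarrow> \<pi> < 1 \<Longrightarrow> 0 < \<delta> \<Longrightarrow>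
       n_B_rob {..<k} p q \<pi> \<delta> \<epsilon> = n_B {..<k} p' q' \<pi> \<delta> \<and> n_B {..<k} p' q' \<pi> \<delta> \<noteq> \<infinity>"
    proof -
      show ?thesis
      proof (rule least_favourable_pair[OF supp \<epsilon>, folded s_def r_def], goal_cases)
        case 1
        then show ?case by (rule that)
      qed
    qed
    \<comment> \<open>Weight and bound stay open, to be instantiated with unit cost and with
      \<open>bit_size\<close>.\<close>
    have computes: "computes_within w least_favourable_com k p q \<epsilon> (400 * c * (k + 1)\<^sup>2) p' q'"
      if "min_level_cost w c k (pmf q) (pmf p) \<epsilon>" "min_level_cost w c k (pmf p) (pmf q) \<epsilon>"
        "\<And>i. i < k \<Longrightarrow> w (s * (pmf p i + pmf q i)) \<le> c" "\<And>i. i < k \<Longrightarrow> w (r * (pmf p i + pmf q i)) \<le> c"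
        "\<And>i. i < k \<Longrightarrow> w (pmf p i + pmf q i - s * (pmf p i + pmf q i)) \<le> c"
        "\<And>i. i < k \<Longrightarrow> w (pmf p i + pmf q i - r * (pmf p i + pmf q i)) \<le> c" for w c
    proof (rule computes_withinI)
      \<comment> \<open>The cut-off at \<open>k\<close> in \<open>input_state\<close> changes
        nothing, because both supports lie below \<open>k\<close>.\<close>
      have "(\<lambda>i. if i < k then pmf p i else 0) = pmf p" "(\<lambda>i. if i < k then pmf q i else 0) = pmf q"
        using supp by (auto simp: pmf_eq_0_set_pmf fun_eq_iff)
      then have input: "fst (input_state k p q \<epsilon>) ''k'' = k" "snd (input_state k p q \<epsilon>) ''p'' = pmf p"
        "snd (input_state k p q \<epsilon>) ''q'' = pmf q" "snd (input_state k p q \<epsilon>) ''eps'' 0 = \<epsilon>"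
        by (simp_all add: input_state_def)
      show "run w least_favourable_com (input_state k p q \<epsilon>)
          (\<lambda>t st. t \<le> 400 * c * (k + 1)\<^sup>2 \<and> output_is k st p' q')"
        by (rule run_mono[OF run_least_favourable_com[OF that(1,2) input s_def r_def that(3-6)]])
          (simp_all add: output_is_def out(3,4))
    qed
    have "computes_within (\<lambda>_. 1) least_favourable_com k p q \<epsilon> (poly T k) p' q'"
      using computes[of "\<lambda>_. 1" 1] by (simp add: T min_level_cost_def)
    moreover have "computes_within bit_size least_favourable_com k p q \<epsilon> (poly B (input_size k p q \<epsilon>)) p' q'"
      if rational: "rational_input k p q \<epsilon>"
    proof -
      define N where "N = input_size k p q \<epsilon>"
      obtain D where D: "0 < D" "D \<le> 2 ^ N" "\<epsilon> * of_int D \<in> \<int>"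
        "\<And>i. i < k \<Longrightarrow> pmf p i * of_int D \<in> \<int>" "\<And>i. i < k \<Longrightarrow> pmf q i * of_int D \<in> \<int>"
        using rational_input_common_denominator[OF rational] unfolding N_def by blast
      have sums: "sum (pmf p) {..<k} = 1" "sum (pmf q) {..<k} = 1"
        using supp by (auto intro: sum_pmf_eq_1)
      have "(\<Sum>i<k. max 0 (pmf p i - pmf q i)) \<le> sum (pmf p) {..<k}"
        by (intro sum_mono) auto
      then have "\<epsilon> \<le> 1" using \<epsilon> sums supp tv_eq_sum_max[of "{..<k}" p q] by simp
      have "k \<le> N" by (simp add: N_def input_size_def)
      \<comment> \<open>The levels \<open>s\<close> and \<open>r\<close> exchange the roles of
        \<open>p\<close> and \<open>q\<close>, so both orders are interpreted with the same
        \<open>D\<close>.\<close>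
      interpret pq: common_denominator k N "pmf p" "pmf q" \<epsilon> D
        by unfold_locales (use D sums \<epsilon>(1) \<open>\<epsilon> \<le> 1\<close> \<open>k \<le> N\<close> in auto)
      interpret qp: common_denominator k N "pmf q" "pmf p" \<epsilon> D
        by unfold_locales (use D sums \<epsilon>(1) \<open>\<epsilon> \<le> 1\<close> \<open>k \<le> N\<close> in auto)
      have "computes_within bit_size least_favourable_com k p q \<epsilon> (400 * (4 * N + 12) * (k + 1)\<^sup>2) p' q'"
        using pq.min_level_cost_bit_size qp.min_level_cost_bit_size
          pq.bit_size_min_level_mult qp.bit_size_min_level_mult
        by (intro computes) (simp_all only: s_def r_def add.commute[of "pmf q _"])
      moreover have "400 * (4 * N + 12) * (k + 1)\<^sup>2 \<le> poly B N"
        unfolding B using \<open>k \<le> N\<close> by (intro mult_left_mono power_mono) auto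
      ultimately show ?thesis
        unfolding computes_within_def N_def by (meson order_trans)
    qed
    moreover have "comparable 1 1 (n_B_rob {..<k} p q \<pi> \<delta> \<epsilon>) (n_B {..<k} p' q' \<pi> \<delta>)"
      if "0 < \<pi>" "\<pi> \<le> 1 / 2" "0 < \<delta>" for \<pi> \<delta>
      using out(5)[of \<pi> \<delta>] that by (auto simp: comparable_def)
    ultimately show ?thesis
      using out(1,2) unfolding efficiently_computes_def by blast
  qed
  then show ?thesis
    by (intro exI[of _ least_favourable_com] exI[of _ T] exI[of _ B] exI[of _ 1]) auto
qed

end
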